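(* Let $p$ be a prime and let $F_p$ denote the field with $p$ elements. Then the group \[ SL_3(F_p[t^{-1}])\ltimes F_p[t,t^{-1}]^3 \] is a non-inner amenable group that is also not properly proximal.
   Context: $SL_3(F_p[t^{-1}])$ acts on the additive group $F_p[t,t^{-1}]^3$ by matrix multiplication, and groups are considered as discrete groups. A discrete group $\Gamma$ is inner amenable if there is a finitely additive probability measure on $\Gamma$ that is invariant under conjugation and gives measure zero to every finite subset. A group $\Gamma$ is properly proximal if there does not exist a left-invariant state (invariant under the action of $\Gamma$ induced by left translation) on the $C^*$-algebra $(\ell^\infty\Gamma/c_0\Gamma)^{\Gamma_r}$ consisting of those elements of $\ell^\infty\Gamma/c_0\Gamma$ that are invariant under the action of $\Gamma$ induced by right translation. *)

theory Defs
  imports "HOL-Analysis.Analysis" "HOL-Algebra.QuotRing" "HOL-Algebra.Module"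
    "HOL-Library.Poly_Mapping"
begin

definition inner_amenable :: "('g, 'm) monoid_scheme \<Rightarrow> bool" where
  "inner_amenable G \<longleftrightarrow> (\<exists>\<mu> :: 'g set \<Rightarrow> real.
     (\<forall>A \<subseteq> carrier G. 0 \<le> \<mu> A) \<and>
     \<mu> (carrier G) = 1 \<and>
     (\<forall>A \<subseteq> carrier G. \<forall>B \<subseteq> carrier G. A \<inter> B = {} \<longrightarrow> \<mu> (A \<union> B) = \<mu> A + \<mu> B) \<and>
     (\<forall>g \<in> carrier G. \<forall>A \<subseteq> carrier G. \<mu> ((\<lambda>x. g \<otimes>\<^bsub>G\<^esub> x \<otimes>\<^bsub>G\<^esub> inv\<^bsub>G\<^esub> g) ` A) = \<mu> A) \<and>
     (\<forall>A \<subseteq> carrier G. finite A \<longrightarrow> \<mu> A = 0))"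

text \<open>The C*-norm is not recorded: the notion of a state of a unital C*-algebra
  only refers to the unital *-algebra structure.\<close>

record 'a star_algebra = "(complex, 'a) module" +
  star :: "'a \<Rightarrow> 'a"

text \<open>A state is a positive linear functional with value 1 at the unit; for a positive
  functional on a unital C*-algebra the latter says that its norm is 1.\<close>

definition is_state :: "('a, 'm) star_algebra_scheme \<Rightarrow> ('a \<Rightarrow> complex) \<Rightarrow> bool" where
  "is_state A \<phi> \<longleftrightarrow>
     (\<forall>x \<in> carrier A. \<forall>y \<in> carrier A. \<phi> (x \<oplus>\<^bsub>A\<^esub> y) = \<phi> x + \<phi> y) \<and>
     (\<forall>c. \<forall>x \<in> carrier A. \<phi> (c \<odot>\<^bsub>A\<^esub> x) = c * \<phi> x) \<and>
     (\<forall>x \<in> carrier A. \<phi> (star A x \<otimes>\<^bsub>A\<^esub> x) \<in> \<real>\<^sub>\<ge>\<^sub>0) \<and>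
     \<phi> \<one>\<^bsub>A\<^esub> = 1"

text \<open>Functions on the group are represented by functions that are
  \<open>undefined\<close> outside the carrier.\<close>

definition linf :: "('g, 'm) monoid_scheme \<Rightarrow> ('g \<Rightarrow> complex) star_algebra" where
  "linf G = \<lparr>
     carrier = {f \<in> extensional (carrier G). bounded (f ` carrier G)},
     mult = (\<lambda>f h. \<lambda>x \<in> carrier G. f x * h x),
     one = (\<lambda>x \<in> carrier G. 1),
     zero = (\<lambda>x \<in> carrier G. 0),
     add = (\<lambda>f h. \<lambda>x \<in> carrier G. f x + h x),
     smult = (\<lambda>c f. \<lambda>x \<in> carrier G. c * f x),
     star = (\<lambda>f. \<lambda>x \<in> carrier G. cnj (f x))\<rparr>"

definition c0 :: "('g, 'm) monoid_scheme \<Rightarrow> ('g \<Rightarrow> complex) set" where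
  "c0 G = {f \<in> carrier (linf G). \<forall>\<epsilon>>0. finite {x \<in> carrier G. \<epsilon> \<le> cmod (f x)}}"

definition left_translate :: "('g, 'm) monoid_scheme \<Rightarrow> 'g \<Rightarrow> ('g \<Rightarrow> complex) \<Rightarrow> 'g \<Rightarrow> complex" where
  "left_translate G g f = (\<lambda>x \<in> carrier G. f (inv\<^bsub>G\<^esub> g \<otimes>\<^bsub>G\<^esub> x))"

definition right_translate :: "('g, 'm) monoid_scheme \<Rightarrow> 'g \<Rightarrow> ('g \<Rightarrow> complex) \<Rightarrow> 'g \<Rightarrow> complex" where
  "right_translate G g f = (\<lambda>x \<in> carrier G. f (x \<otimes>\<^bsub>G\<^esub> g))"

text \<open>The quotient algebra. Its elements are cosets of \<open>c0\<close>. The scalar \<open>c\<close> acts as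
  multiplication by the class of the constant function \<open>c\<close>, because the elementwise image of a
  coset under multiplication by \<open>0\<close> is not a coset. The involution, and below the translations,
  map \<open>c0\<close> bijectively to itself, so there the induced map is the elementwise image.\<close>

definition linf_mod_c0 :: "('g, 'm) monoid_scheme \<Rightarrow> ('g \<Rightarrow> complex) set star_algebra" where
  "linf_mod_c0 G = (let Q = linf G Quot c0 G in \<lparr>
     carrier = carrier Q,
     mult = mult Q,
     one = one Q,
     zero = zero Q,
     add = add Q,
     smult = (\<lambda>c F. (c0 G +>\<^bsub>linf G\<^esub> (c \<odot>\<^bsub>linf G\<^esub> \<one>\<^bsub>linf G\<^esub>)) \<otimes>\<^bsub>Q\<^esub> F),
     star = (\<lambda>F. star (linf G) ` F)\<rparr>)"

definition right_invariants :: "('g, 'm) monoid_scheme \<Rightarrow> ('g \<Rightarrow> complex) set star_algebra" where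
  "right_invariants G = (linf_mod_c0 G)\<lparr>carrier :=
     {F \<in> carrier (linf_mod_c0 G). \<forall>g \<in> carrier G. right_translate G g ` F = F}\<rparr>"

definition properly_proximal :: "('g, 'm) monoid_scheme \<Rightarrow> bool" where
  "properly_proximal G \<longleftrightarrow> \<not> (\<exists>\<phi>. is_state (right_invariants G) \<phi> \<and>
     (\<forall>g \<in> carrier G. \<forall>F \<in> carrier (right_invariants G). \<phi> (left_translate G g ` F) = \<phi> F))"

definition semidirect_product ::
  "('g, 'm) monoid_scheme \<Rightarrow> ('n, 'k) monoid_scheme \<Rightarrow> ('g \<Rightarrow> 'n \<Rightarrow> 'n) \<Rightarrow> ('g \<times> 'n) monoid" where
  "semidirect_product G N act = \<lparr>
     carrier = carrier G \<times> carrier N,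
     mult = (\<lambda>(g, u) (h, v). (g \<otimes>\<^bsub>G\<^esub> h, u \<otimes>\<^bsub>N\<^esub> act g v)),
     one = (\<one>\<^bsub>G\<^esub>, \<one>\<^bsub>N\<^esub>)\<rparr>"

definition special_linear :: "'a::comm_ring_1 set \<Rightarrow> ('a ^ 'n ^ 'n) monoid" where
  "special_linear R = \<lparr>
     carrier = {A. (\<forall>i j. A $ i $ j \<in> R) \<and> det A = 1},
     mult = (**),
     one = mat 1\<rparr>"

definition additive_group :: "'a::ab_group_add monoid" where
  "additive_group = \<lparr>carrier = UNIV, mult = (+), one = 0\<rparr>"

text \<open>Laurent polynomials: the coefficient of \<open>t\<^sup>n\<close> in \<open>f\<close> is \<open>Poly_Mapping.lookup f n\<close>,
  and multiplication on this type is convolution.\<close>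

type_synonym 'k laurent = "int \<Rightarrow>\<^sub>0 'k"

definition polys_in_t_inverse :: "'k::field laurent set" where
  "polys_in_t_inverse = {f. Poly_Mapping.keys f \<subseteq> {..0}}"

definition SL3_semidirect :: "(('k::field laurent ^ 3 ^ 3) \<times> ('k laurent ^ 3)) monoid" where
  "SL3_semidirect = semidirect_product (special_linear polys_in_t_inverse) additive_group (*v)"

end

theory Submission
  imports Defs
begin

text \<open>Write \<open>H\<close> for \<open>SL\<^sub>3\<close> over the polynomials in \<open>t\<^sup>-\<^sup>1\<close>, and \<open>N\<close> for the group of vectors of Laurent
  polynomials.

  The group is not inner amenable, by a ping-pong argument. Let a conjugation-invariant mean be given.
  Conjugation by a transvection of \<open>H\<close> with parameter \<open>t\<^sup>-\<^sup>k\<close> acts on the vector and on the entries of the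
  matrix. Where the entry that is multiplied by a power of \<open>t\<^sup>-\<^sup>1\<close> has the least order at \<open>t = 0\<close>
  among the entries concerned, the result has an entry whose relative order is a known injective
  function of \<open>k\<close>. So infinitely many conjugates of such a set are disjoint, and the set is null
  (\<open>null_of_label\<close>). Finitely many sets that are null for this reason, or that one further conjugation
  carries into such a set, cover everything except the pairs of a scalar matrix and the zero vector
  (\<open>not_inner_amenable_SL3_semidirect\<close>). Only finitely many of these pairs lie in the group, so the mean
  vanishes identically, which is absurd.

  The group is not properly proximal, because averaging over finite subsets of \<open>N\<close> gives an invariant
  state. Let \<open>F n\<close> be the finite set of vectors with exponents between 1 and \<open>n\<close>. An element \<open>h\<close> of \<open>H\<close>
  does not preserve \<open>F n\<close>. It preserves the vectors with exponents at most \<open>n\<close> and those with exponents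
  at most 0, so taking the part of \<open>h v\<close> with positive exponents permutes \<open>F n\<close>
  (\<open>SL3_moves_positive_part\<close>). The discarded part takes only finitely many values, uniformly in \<open>n\<close>
  (\<open>SL3_bounded_remainder\<close>). Since \<open>N\<close> is abelian and \<open>h v = (h \<cdot> v) h\<close> in the group, left translation of
  \<open>F n\<close> thus agrees, up to a permutation of \<open>F n\<close>, with right translations by elements of a fixed finite
  set. Functions that are invariant under right translation modulo \<open>c0\<close> do not feel these, so
  a generalized limit of the averages over \<open>F n\<close> is a left-invariant state
  (\<open>escaping_sequence.not_properly_proximal\<close>).\<close>

section \<open>Special linear groups and semidirect products\<close>

lemma group_semidirect_product:
  fixes G (structure) and N (structure)
  assumes "group G" "group N"
    and closed: "\<And>g v. g \<in> carrier G \<Longrightarrow> v \<in> carrier N \<Longrightarrow> act g v \<in> carrier N"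
    and hom: "\<And>g u v. g \<in> carrier G \<Longrightarrow> u \<in> carrier N \<Longrightarrow> v \<in> carrier N \<Longrightarrow>
      act g (u \<otimes>\<^bsub>N\<^esub> v) = act g u \<otimes>\<^bsub>N\<^esub> act g v"
    and comp: "\<And>g h v. g \<in> carrier G \<Longrightarrow> h \<in> carrier G \<Longrightarrow> v \<in> carrier N \<Longrightarrow>
      act (g \<otimes>\<^bsub>G\<^esub> h) v = act g (act h v)"
    and one: "\<And>v. v \<in> carrier N \<Longrightarrow> act \<one>\<^bsub>G\<^esub> v = v"
  shows "group (semidirect_product G N act)"
proof -
  interpret G: group G by fact
  interpret N: group N by fact
  show ?thesis
  proof (rule groupI)
    fix x assume "x \<in> carrier (semidirect_product G N act)"
    then obtain g u where x: "x = (g, u)" "g \<in> carrier G" "u \<in> carrier N"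
      by (auto simp: semidirect_product_def)
    have "act (inv\<^bsub>G\<^esub> g) (inv\<^bsub>N\<^esub> u) \<otimes>\<^bsub>N\<^esub> act (inv\<^bsub>G\<^esub> g) u = act (inv\<^bsub>G\<^esub> g) \<one>\<^bsub>N\<^esub>"
      using x by (simp flip: hom)
    also have "\<dots> = \<one>\<^bsub>N\<^esub>"
      using x hom[of "inv\<^bsub>G\<^esub> g" "\<one>\<^bsub>N\<^esub>" "\<one>\<^bsub>N\<^esub>"] closed[of "inv\<^bsub>G\<^esub> g" "\<one>\<^bsub>N\<^esub>"] by simp
    finally show "\<exists>y\<in>carrier (semidirect_product G N act).
        y \<otimes>\<^bsub>semidirect_product G N act\<^esub> x = \<one>\<^bsub>semidirect_product G N act\<^esub>"
      using x closed
      by (intro bexI[of _ "(inv\<^bsub>G\<^esub> g, act (inv\<^bsub>G\<^esub> g) (inv\<^bsub>N\<^esub> u))"])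
        (auto simp: semidirect_product_def)
  qed (auto simp: semidirect_product_def closed hom comp one G.m_assoc N.m_assoc)
qed

lemma three_eq_zero: "(3::3) = 0"
  using exhaust_3[of 0] by auto

lemma numerals_mod_3: "(4::3) = 1"  "(5::3) = 2"
proof -
  have "(4::3) = 3 + 1" "(5::3) = 3 + 2" by simp_all
  then show "(4::3) = 1"  "(5::3) = 2" by (simp_all only: three_eq_zero add_0_left)
qed

text \<open>The indices are integers modulo 3: the minor that omits row \<open>j\<close> and column \<open>i\<close>, with its rows
  and columns in cyclic order, already carries the cofactor sign.\<close>

definition adjugate3 :: "'a::comm_ring_1 ^ 3 ^ 3 \<Rightarrow> 'a ^ 3 ^ 3" where
  "adjugate3 A = (\<chi> i j. A $ (j + 1) $ (i + 1) * A $ (j + 2) $ (i + 2)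
                       - A $ (j + 1) $ (i + 2) * A $ (j + 2) $ (i + 1))"

lemma adjugate3_mult: "adjugate3 A ** A = mat (det A)"
  by (simp add: vec_eq_iff forall_3 adjugate3_def matrix_matrix_mult_def mat_def det_3 sum_3 numerals_mod_3
      algebra_simps)

lemma group_special_linear3:
  assumes R: "\<And>a b. a \<in> R \<Longrightarrow> b \<in> R \<Longrightarrow> a + b \<in> R" "\<And>a b. a \<in> R \<Longrightarrow> b \<in> R \<Longrightarrow> a * b \<in> R"
    "\<And>a. a \<in> R \<Longrightarrow> - a \<in> R" "0 \<in> R" "1 \<in> R"
  shows "group (special_linear R :: ('a::comm_ring_1 ^ 3 ^ 3) monoid)"
proof (rule groupI)
  fix A :: "'a ^ 3 ^ 3" assume "A \<in> carrier (special_linear R)"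
  then have A: "A $ i $ j \<in> R" "det A = 1" for i j
    by (auto simp: special_linear_def)
  have "a - b \<in> R" if "a \<in> R" "b \<in> R" for a b
    using R(1)[of a "- b"] R(3) that by simp
  then have "adjugate3 A $ i $ j \<in> R" for i j
    by (simp add: adjugate3_def A R)
  moreover have "det (adjugate3 A) = 1"
    using det_mul[of "adjugate3 A" A] by (simp add: adjugate3_mult A(2) det_I)
  ultimately show "\<exists>B \<in> carrier (special_linear R). B \<otimes>\<^bsub>special_linear R\<^esub> A = \<one>\<^bsub>special_linear R\<^esub>"
    by (intro bexI[of _ "adjugate3 A"]) (auto simp: special_linear_def adjugate3_mult A(2))
next
  have "(A ** B) $ i $ j \<in> R" if "\<And>i j. A $ i $ j \<in> R" "\<And>i j. B $ i $ j \<in> R"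
    for A B :: "'a ^ 3 ^ 3" and i j
    using that by (simp add: matrix_matrix_mult_def sum_3 R)
  moreover have "(mat 1 :: 'a ^ 3 ^ 3) $ i $ j \<in> R" for i j
    by (simp add: mat_def R)
  ultimately show "\<one>\<^bsub>special_linear R\<^esub> \<in> carrier (special_linear R :: ('a ^ 3 ^ 3) monoid)"
    "\<And>A B. A \<in> carrier (special_linear R :: ('a ^ 3 ^ 3) monoid) \<Longrightarrow> B \<in> carrier (special_linear R) \<Longrightarrow>
      A \<otimes>\<^bsub>special_linear R\<^esub> B \<in> carrier (special_linear R)"
    by (auto simp: special_linear_def det_mul)
qed (auto simp: special_linear_def matrix_mul_assoc)

lemma polys_in_t_inverse_iff:
  "f \<in> polys_in_t_inverse \<longleftrightarrow> (\<forall>n>0. Poly_Mapping.lookup f n = 0)"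
  by (auto simp: polys_in_t_inverse_def in_keys_iff subset_iff) (meson linorder_not_le)

lemma polys_in_t_inverse_mult:
  "f \<in> polys_in_t_inverse \<Longrightarrow> g \<in> polys_in_t_inverse \<Longrightarrow> f * g \<in> polys_in_t_inverse"
  using keys_mult[of f g] by (fastforce simp: polys_in_t_inverse_def)

lemma group_SL3: "group (special_linear polys_in_t_inverse :: ('k::field laurent ^ 3 ^ 3) monoid)"
  by (rule group_special_linear3; (rule polys_in_t_inverse_mult; assumption)?)
    (auto simp: polys_in_t_inverse_iff lookup_add lookup_one)

lemma group_additive_group: "group (additive_group :: 'a::ab_group_add monoid)"
proof (rule groupI)
  show "\<exists>y\<in>carrier additive_group. y \<otimes>\<^bsub>additive_group\<^esub> x = \<one>\<^bsub>additive_group\<^esub>" for x :: 'a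
    by (auto simp: additive_group_def intro: exI[of _ "- x"])
qed (auto simp: additive_group_def add.assoc)

lemma group_SL3_semidirect:
  "group (SL3_semidirect :: (('k::field laurent ^ 3 ^ 3) \<times> ('k laurent ^ 3)) monoid)"
  unfolding SL3_semidirect_def
  by (rule group_semidirect_product[OF group_SL3 group_additive_group])
    (auto simp: additive_group_def special_linear_def matrix_vector_right_distrib
      matrix_vector_mul_assoc)

lemma SL3_semidirect_simps:
  "x \<in> carrier SL3_semidirect \<longleftrightarrow> fst x \<in> carrier (special_linear polys_in_t_inverse)"
  "(g, u) \<otimes>\<^bsub>SL3_semidirect\<^esub> (h, v) = (g ** h, u + g *v v)"
  "\<one>\<^bsub>SL3_semidirect\<^esub> = (mat 1, 0)"
  by (cases x) (simp_all add: SL3_semidirect_def semidirect_product_def additive_group_def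
      special_linear_def)

section \<open>Conjugation by transvections\<close>

definition transvection :: "'n \<Rightarrow> 'n \<Rightarrow> 'a::comm_ring_1 \<Rightarrow> 'a ^ 'n ^ 'n" where
  "transvection i j q = (\<chi> r c. if r = c then 1 else if r = i \<and> c = j then q else 0)"

lemma det_transvection:
  "i \<noteq> j \<Longrightarrow> det (transvection i j q) = 1"
proof -
  assume ij: "i \<noteq> j"
  have "transvection i j q = (\<chi> k. if k = i then row i (mat 1) + q *s row j (mat 1) else row k (mat 1))"
    using ij by (auto simp: transvection_def row_def mat_def vec_eq_iff)
  then show ?thesis
    using det_row_operation[OF ij, of "mat 1" q] by simp
qed

lemma transvection_mult_left:
  fixes A :: "'a::comm_ring_1 ^ 'm ^ 'n"
  assumes "i \<noteq> j"
  shows "(transvection i j q ** A) $ r $ c = A $ r $ c + (if r = i then q * A $ j $ c else 0)"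
proof -
  have "(transvection i j q ** A) $ r $ c
      = (\<Sum>k\<in>UNIV. (if k = r then A $ r $ c else 0) + (if k = j then if r = i then q * A $ j $ c else 0 else 0))"
    unfolding matrix_matrix_mult_def transvection_def vec_lambda_beta
    by (rule sum.cong) (use assms in auto)
  also have "\<dots> = A $ r $ c + (if r = i then q * A $ j $ c else 0)"
    by (simp add: sum.distrib)
  finally show ?thesis .
qed

lemma transvection_mult_right:
  fixes A :: "'a::comm_ring_1 ^ 'n ^ 'm"
  assumes "i \<noteq> j"
  shows "(A ** transvection i j q) $ r $ c = A $ r $ c + (if c = j then A $ r $ i * q else 0)"
proof -
  have "(A ** transvection i j q) $ r $ c
      = (\<Sum>k\<in>UNIV. (if k = c then A $ r $ c else 0) + (if k = i then if c = j then A $ r $ i * q else 0 else 0))"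
    unfolding matrix_matrix_mult_def transvection_def vec_lambda_beta
    by (rule sum.cong) (use assms in auto)
  also have "\<dots> = A $ r $ c + (if c = j then A $ r $ i * q else 0)"
    by (simp add: sum.distrib)
  finally show ?thesis .
qed

lemma transvection_mult_vector:
  fixes v :: "'a::comm_ring_1 ^ 'n"
  assumes "i \<noteq> j"
  shows "(transvection i j q *v v) $ r = v $ r + (if r = i then q * v $ j else 0)"
proof -
  have "(transvection i j q *v v) $ r
      = (\<Sum>k\<in>UNIV. (if k = r then v $ r else 0) + (if k = j then if r = i then q * v $ j else 0 else 0))"
    unfolding matrix_vector_mult_def transvection_def vec_lambda_beta
    by (rule sum.cong) (use assms in auto)
  also have "\<dots> = v $ r + (if r = i then q * v $ j else 0)"
    by (simp add: sum.distrib)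
  finally show ?thesis .
qed

lemma transvection_inverse:
  "i \<noteq> j \<Longrightarrow> transvection i j q ** transvection i j (- q) = mat 1"
  by (simp add: vec_eq_iff transvection_mult_left) (auto simp: transvection_def mat_def)

text \<open>Conjugation by the element \<open>(transvection i j q, 0)\<close>, with the inverse already computed.\<close>

definition transvection_conj ::
  "3 \<Rightarrow> 3 \<Rightarrow> 'k::field laurent \<Rightarrow> ('k laurent ^ 3 ^ 3) \<times> ('k laurent ^ 3) \<Rightarrow>
    ('k laurent ^ 3 ^ 3) \<times> ('k laurent ^ 3)" where
  "transvection_conj i j q x =
     (transvection i j q ** fst x ** transvection i j (- q), transvection i j q *v snd x)"

lemma transvection_in_SL3:
  assumes "i \<noteq> j" "q \<in> polys_in_t_inverse"
  shows "transvection i j q \<in> carrier (special_linear polys_in_t_inverse)"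
  using assms det_transvection[OF assms(1), of q]
  by (auto simp: special_linear_def transvection_def polys_in_t_inverse_iff lookup_one)

lemma transvection_conj_eq:
  assumes ij: "i \<noteq> j" and q: "q \<in> polys_in_t_inverse"
  shows "(transvection i j q, 0) \<otimes>\<^bsub>SL3_semidirect\<^esub> x
      \<otimes>\<^bsub>SL3_semidirect\<^esub> inv\<^bsub>SL3_semidirect\<^esub> (transvection i j q, 0) = transvection_conj i j q x"
proof -
  have q': "- q \<in> polys_in_t_inverse"
    using q by (simp add: polys_in_t_inverse_iff)
  have "inv\<^bsub>SL3_semidirect\<^esub> (transvection i j q, 0) = (transvection i j (- q), 0)"
    using transvection_inverse[OF ij, of q] transvection_inverse[OF ij, of "- q"]
      transvection_in_SL3[OF ij q] transvection_in_SL3[OF ij q']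
    by (intro group.inv_equality[OF group_SL3_semidirect])
      (auto simp: SL3_semidirect_simps)
  then show ?thesis
    by (cases x) (simp add: SL3_semidirect_simps transvection_conj_def)
qed

text \<open>The diagonal difference and the two opposite entries transform among themselves, as
  under the adjoint representation of \<open>SL\<^sub>2\<close>: the entry \<open>(j, i)\<close> is fixed, and the entry \<open>(i, j)\<close> becomes a
  quadratic polynomial in \<open>q\<close> with leading coefficient minus that fixed entry.\<close>

lemma transvection_conj_entries:
  fixes M :: "'k::field laurent ^ 3 ^ 3"
  assumes "i \<noteq> j"
  shows "fst (transvection_conj i j q (M, v)) $ j $ i = M $ j $ i"
    and "fst (transvection_conj i j q (M, v)) $ i $ j
          = M $ i $ j + q * (M $ j $ j - M $ i $ i) - q * q * M $ j $ i"
    and "fst (transvection_conj i j q (M, v)) $ i $ i = M $ i $ i + q * M $ j $ i"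
    and "fst (transvection_conj i j q (M, v)) $ j $ j = M $ j $ j - q * M $ j $ i"
    and "snd (transvection_conj i j q (M, v)) $ i = v $ i + q * v $ j"
    and "snd (transvection_conj i j q (M, v)) $ j = v $ j"
  using assms by (simp_all add: transvection_conj_def transvection_mult_left transvection_mult_right
      transvection_mult_vector algebra_simps)

section \<open>Null sets of invariant means\<close>

locale invariant_mean =
  fixes X :: "'a set" and \<Gamma> :: "('a \<Rightarrow> 'a) set" and \<mu> :: "'a set \<Rightarrow> real"
  assumes nonneg: "A \<subseteq> X \<Longrightarrow> 0 \<le> \<mu> A"
    and total: "\<mu> X = 1"
    and additive: "A \<subseteq> X \<Longrightarrow> B \<subseteq> X \<Longrightarrow> A \<inter> B = {} \<Longrightarrow> \<mu> (A \<union> B) = \<mu> A + \<mu> B"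
    and invariant: "T \<in> \<Gamma> \<Longrightarrow> A \<subseteq> X \<Longrightarrow> \<mu> (T ` A) = \<mu> A"
    and maps: "T \<in> \<Gamma> \<Longrightarrow> x \<in> X \<Longrightarrow> T x \<in> X"
begin

definition null :: "'a set \<Rightarrow> bool" where
  "null A \<longleftrightarrow> A \<subseteq> X \<and> \<mu> A = 0"

lemma mono: "A \<subseteq> B \<Longrightarrow> B \<subseteq> X \<Longrightarrow> \<mu> A \<le> \<mu> B"
  using additive[of A "B - A"] nonneg[of "B - A"]
  by (simp add: Un_absorb1 Diff_subset subset_trans[of A B X] subset_trans[of "B - A" B X])

lemma null_subset: "null B \<Longrightarrow> A \<subseteq> B \<Longrightarrow> null A"
  using mono[of A B] nonneg[of A] by (force simp: null_def)

lemma null_Un: "null A \<Longrightarrow> null B \<Longrightarrow> null (A \<union> B)"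
  using additive[of A "B - A"] null_subset[of B "B - A"] by (auto simp: null_def)

lemma null_empty: "null {}"
  using additive[of "{}" "{}"] by (simp add: null_def)

lemma null_UN: "finite I \<Longrightarrow> (\<And>i. i \<in> I \<Longrightarrow> null (A i)) \<Longrightarrow> null (\<Union>i\<in>I. A i)"
  by (induction I rule: finite_induct) (auto intro: null_Un null_empty)

lemma null_of_image:
  assumes "T \<in> \<Gamma>" "A \<subseteq> X" "null B" "\<And>x. x \<in> A \<Longrightarrow> T x \<in> B"
  shows "null A"
  using null_subset[of B "T ` A"] invariant[of T A] assms by (auto simp: null_def)

lemma sum_disjoint:
  assumes "finite I" "\<And>i. i \<in> I \<Longrightarrow> A i \<subseteq> X" "disjoint_family_on A I"
  shows "\<mu> (\<Union>i\<in>I. A i) = (\<Sum>i\<in>I. \<mu> (A i))"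
  using assms
proof (induction I rule: finite_induct)
  case empty
  then show ?case using null_empty by (simp add: null_def)
next
  case (insert i I)
  have "A i \<inter> (\<Union>j\<in>I. A j) = {}" "disjoint_family_on A I"
    using insert.prems(2) insert.hyps by (fastforce simp: disjoint_family_on_def)+
  then show ?case
    using insert additive[of "A i" "\<Union>j\<in>I. A j"] by (auto simp: UN_subset_iff)
qed

text \<open>The label tells which \<open>T k\<close> was applied, so the infinitely many images \<open>T k ` A\<close>
  are disjoint. They have equal measure and total measure at most 1, so that measure is 0.\<close>

lemma null_of_label:
  fixes T :: "nat \<Rightarrow> 'a \<Rightarrow> 'a"
  assumes T: "\<And>k. T k \<in> \<Gamma>" and A: "A \<subseteq> X" and "inj e"
    and label: "\<And>k x. x \<in> A \<Longrightarrow> label (T k x) = e k"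
  shows "null A"
proof -
  have disj: "disjoint_family_on (\<lambda>k. T k ` A) I" for I
    unfolding disjoint_family_on_def using label injD[OF \<open>inj e\<close>]
    by (metis (no_types, lifting) disjoint_iff image_iff)
  have sub: "T k ` A \<subseteq> X" for k
    using maps[OF T] A by auto
  have "real n * \<mu> A \<le> 1" for n
  proof -
    have "real n * \<mu> A = (\<Sum>k<n. \<mu> (T k ` A))"
      by (simp add: invariant[OF T A])
    also have "\<dots> = \<mu> (\<Union>k<n. T k ` A)"
      using sub disj by (intro sum_disjoint[symmetric]) auto
    also have "\<dots> \<le> 1"
      using mono[of "\<Union>k<n. T k ` A" X] sub total by auto
    finally show ?thesis .
  qed
  then have "\<not> 0 < \<mu> A"
    by (meson ex_less_of_nat_mult linorder_not_le)
  then show ?thesis using nonneg[OF A] A by (simp add: null_def)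
qed

lemma not_null_carrier: "\<not> null X"
  by (simp add: null_def total)

end

lemma inner_amenableE:
  fixes G (structure)
  assumes "group G" "inner_amenable G"
  obtains \<mu> where "invariant_mean (carrier G) ((\<lambda>g x. g \<otimes> x \<otimes> inv g) ` carrier G) \<mu>"
    "\<And>A. A \<subseteq> carrier G \<Longrightarrow> finite A \<Longrightarrow> \<mu> A = 0"
proof -
  interpret group G by fact
  obtain \<mu> :: "_ \<Rightarrow> real" where \<mu>: "\<forall>A \<subseteq> carrier G. 0 \<le> \<mu> A" "\<mu> (carrier G) = 1"
    "\<forall>A \<subseteq> carrier G. \<forall>B \<subseteq> carrier G. A \<inter> B = {} \<longrightarrow> \<mu> (A \<union> B) = \<mu> A + \<mu> B"
    "\<forall>g \<in> carrier G. \<forall>A \<subseteq> carrier G. \<mu> ((\<lambda>x. g \<otimes> x \<otimes> inv g) ` A) = \<mu> A"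
    "\<forall>A \<subseteq> carrier G. finite A \<longrightarrow> \<mu> A = 0"
    using assms(2) unfolding inner_amenable_def by (elim exE conjE)
  show thesis
  proof (rule that)
    show "invariant_mean (carrier G) ((\<lambda>g x. g \<otimes> x \<otimes> inv g) ` carrier G) \<mu>"
      by unfold_locales (use \<mu> in \<open>auto\<close>)
  qed (use \<mu>(5) in blast)
qed

section \<open>Orders of Laurent polynomials\<close>

definition vanishes_below :: "'k::field laurent \<Rightarrow> int \<Rightarrow> bool" where
  "vanishes_below f n \<longleftrightarrow> (\<forall>i<n. Poly_Mapping.lookup f i = 0)"

definition has_order :: "'k::field laurent \<Rightarrow> int \<Rightarrow> bool" where
  "has_order f n \<longleftrightarrow> vanishes_below f n \<and> Poly_Mapping.lookup f n \<noteq> 0"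

definition t_order :: "'k::field laurent \<Rightarrow> int" where
  "t_order f = (THE n. has_order f n)"

text \<open>For \<open>f \<noteq> 0\<close>: the order of \<open>g\<close> at \<open>t = 0\<close> is at least that of \<open>f\<close>, where 0 has order infinity.\<close>

definition dominates :: "'k::field laurent \<Rightarrow> 'k laurent \<Rightarrow> bool" where
  "dominates f g \<longleftrightarrow> (\<exists>n. has_order f n \<and> vanishes_below g n)"

abbreviation t_power :: "int \<Rightarrow> 'k::field laurent" where
  "t_power n \<equiv> Poly_Mapping.single n 1"

lemma t_order_eq: "has_order f n \<Longrightarrow> t_order f = n"
  unfolding t_order_def
  by (rule the_equality) (auto simp: has_order_def vanishes_below_def, metis linorder_neqE_linordered_idom)

lemma lookup_t_power_mult:
  "Poly_Mapping.lookup (t_power m * f) n = Poly_Mapping.lookup f (n - m)"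
proof -
  have "Poly_Mapping.lookup (t_power m * f) n =
      (\<Sum>l. (1 when m = l) * (\<Sum>q. Poly_Mapping.lookup f q when n = l + q))"
    by (simp add: lookup_mult lookup_single)
  also have "\<dots> = (\<Sum>l. (\<Sum>q. Poly_Mapping.lookup f q when n = l + q) when m = l)"
    by (intro Sum_any.cong) (simp add: when_def)
  also have "\<dots> = (\<Sum>q. Poly_Mapping.lookup f q when n = m + q)"
    by simp
  also have "\<dots> = (\<Sum>q. Poly_Mapping.lookup f q when q = n - m)"
    by (intro Sum_any.cong) (auto simp: when_def)
  finally show ?thesis by simp
qed

lemma common_order:
  assumes "finite S" "\<exists>f\<in>S. f \<noteq> 0"
  shows "\<exists>n. (\<forall>f\<in>S. vanishes_below f n) \<and> (\<exists>f\<in>S. has_order f n)"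
proof -
  define K where "K = (\<Union>f\<in>S. Poly_Mapping.keys f)"
  have K: "finite K" "K \<noteq> {}"
    using assms by (auto simp: K_def keys_eq_empty)
  have below: "vanishes_below f (Min K)" if "f \<in> S" for f
    unfolding vanishes_below_def
  proof (intro allI impI)
    fix i assume "i < Min K"
    then have "i \<notin> K" using K by (meson Min_le linorder_not_le)
    then show "Poly_Mapping.lookup f i = 0"
      using that by (auto simp: K_def in_keys_iff)
  qed
  have "Min K \<in> K" using K by simp
  then obtain f where "f \<in> S" "Poly_Mapping.lookup f (Min K) \<noteq> 0"
    by (auto simp: K_def in_keys_iff)
  then show ?thesis
    using below unfolding has_order_def by blast
qed

lemma dominates_total: "f \<noteq> 0 \<Longrightarrow> dominates f g \<or> dominates g f"
  using common_order[of "{f, g}"] by (auto simp: dominates_def)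

lemma dominates_iff: "has_order f n \<Longrightarrow> dominates f g \<longleftrightarrow> vanishes_below g n"
  unfolding dominates_def by (metis t_order_eq)

text \<open>Multiplication by a negative power of \<open>t\<close> strictly lowers the order, so the multiple of the
  dominating entry determines the order of the sum.\<close>

lemma has_order_translate:
  assumes "has_order f n" "vanishes_below g n" "m < 0"
  shows "has_order (g + t_power m * f) (n + m)"
  using assms by (auto simp: has_order_def vanishes_below_def lookup_add lookup_t_power_mult)

lemma has_order_quadratic:
  assumes "has_order a n" "vanishes_below b n" "vanishes_below c n" "m < 0"
  shows "has_order (c + t_power m * b - t_power m * t_power m * a) (n + 2 * m)"
  using assms by (auto simp: has_order_def vanishes_below_def lookup_add lookup_minus
      lookup_t_power_mult mult.assoc)

section \<open>Failure of inner amenability\<close>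

lemma finite_cube_roots_of_one: "finite {c :: 'a::idom. c ^ 3 = 1}"
proof -
  define P :: "'a poly" where "P = monom 1 3 - 1"
  have "poly.coeff P 3 = 1" by (simp add: P_def)
  then have "P \<noteq> 0" by auto
  then show ?thesis
    using poly_roots_finite[of P] by (simp add: P_def poly_monom)
qed

text \<open>A ping-pong argument with the transvections whose parameter is a negative power of \<open>t\<close>.
  After conjugation by one of them, the order of a changed entry relative to an unchanged one
  reveals the exponent. This makes \<open>V i j\<close> (for vectors) and \<open>P i j\<close> (for matrices) null. The remaining
  case \<open>Q i j\<close>, in which the diagonal difference is strictly dominant, is moved into \<open>P j i\<close> by the
  transvection with parameter 1. What these sets leave over is the set of pairs of a scalar matrix of
  determinant 1 and the zero vector, which is finite.\<close>

lemma not_inner_amenable_SL3_semidirect: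
  "\<not> inner_amenable (SL3_semidirect :: (('k::field laurent ^ 3 ^ 3) \<times> ('k laurent ^ 3)) monoid)"
proof
  let ?G = "SL3_semidirect :: (('k laurent ^ 3 ^ 3) \<times> ('k laurent ^ 3)) monoid"
  assume "inner_amenable ?G"
  define \<Gamma> where "\<Gamma> = (\<lambda>g x. g \<otimes>\<^bsub>?G\<^esub> x \<otimes>\<^bsub>?G\<^esub> inv\<^bsub>?G\<^esub> g) ` carrier ?G"
  obtain \<mu> where "invariant_mean (carrier ?G) \<Gamma> \<mu>"
    and finite_zero: "\<And>A. A \<subseteq> carrier ?G \<Longrightarrow> finite A \<Longrightarrow> \<mu> A = 0"
    using inner_amenableE[OF group_SL3_semidirect \<open>inner_amenable ?G\<close>] unfolding \<Gamma>_def by blast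
  then interpret invariant_mean "carrier ?G" \<Gamma> \<mu> by simp
  have T: "transvection_conj i j q \<in> \<Gamma>" if "i \<noteq> j" "q \<in> polys_in_t_inverse" for i j q
    unfolding \<Gamma>_def
  proof (rule image_eqI)
    show "transvection_conj i j q = (\<lambda>x. (transvection i j q, 0) \<otimes>\<^bsub>?G\<^esub> x \<otimes>\<^bsub>?G\<^esub> inv\<^bsub>?G\<^esub> (transvection i j q, 0))"
      using transvection_conj_eq[OF that] by (simp add: fun_eq_iff)
    show "(transvection i j q, 0) \<in> carrier ?G"
      using transvection_in_SL3[OF that] by (simp add: SL3_semidirect_simps)
  qed
  \<comment> \<open>The exponent starts at -1 because an exponent 0 would not change the order.\<close>
  have t_power: "t_power (- 1 - int k) \<in> (polys_in_t_inverse :: 'k laurent set)" for k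
    by (simp add: polys_in_t_inverse_iff lookup_single)
  define V where "V i j = {x \<in> carrier ?G. dominates (snd x $ j) (snd x $ i)}" for i j
  define P where "P i j = {x \<in> carrier ?G. dominates (fst x $ j $ i) (fst x $ j $ j - fst x $ i $ i) \<and>
      dominates (fst x $ j $ i) (fst x $ i $ j)}" for i j
  define Q where "Q i j = {x \<in> carrier ?G. \<exists>n. has_order (fst x $ j $ j - fst x $ i $ i) n \<and>
      vanishes_below (fst x $ i $ j) (n + 1) \<and> vanishes_below (fst x $ j $ i) (n + 1)}" for i j
  define Z where "Z = {x \<in> carrier ?G. snd x = 0 \<and> (\<exists>c. fst x = mat c)}"
  have V: "null (V i j)" if ij: "i \<noteq> j" for i j
  proof (rule null_of_label[where T = "\<lambda>k. transvection_conj i j (t_power (- 1 - int k))"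
        and e = "\<lambda>k. - 1 - int k" and label = "\<lambda>y. t_order (snd y $ i) - t_order (snd y $ j)"])
    show "transvection_conj i j (t_power (- 1 - int k)) \<in> \<Gamma>" for k
      by (rule T[OF ij t_power])
    show "t_order (snd (transvection_conj i j (t_power (- 1 - int k)) x) $ i)
        - t_order (snd (transvection_conj i j (t_power (- 1 - int k)) x) $ j) = - 1 - int k"
      if "x \<in> V i j" for k x
    proof -
      from that obtain n where "has_order (snd x $ j) n" "vanishes_below (snd x $ i) n"
        by (auto simp: V_def dominates_def)
      then show ?thesis
        using has_order_translate[of "snd x $ j" n "snd x $ i" "- 1 - int k"]
        by (cases x) (simp add: transvection_conj_entries[OF ij] t_order_eq)
    qed
  qed (auto simp: V_def inj_def)
  have P: "null (P i j)" if ij: "i \<noteq> j" for i j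
  proof (rule null_of_label[where T = "\<lambda>k. transvection_conj i j (t_power (- 1 - int k))"
        and e = "\<lambda>k. 2 * (- 1 - int k)" and label = "\<lambda>y. t_order (fst y $ i $ j) - t_order (fst y $ j $ i)"])
    show "transvection_conj i j (t_power (- 1 - int k)) \<in> \<Gamma>" for k
      by (rule T[OF ij t_power])
    show "t_order (fst (transvection_conj i j (t_power (- 1 - int k)) x) $ i $ j)
        - t_order (fst (transvection_conj i j (t_power (- 1 - int k)) x) $ j $ i) = 2 * (- 1 - int k)"
      if "x \<in> P i j" for k x
    proof -
      from that have d: "dominates (fst x $ j $ i) (fst x $ j $ j - fst x $ i $ i)"
        "dominates (fst x $ j $ i) (fst x $ i $ j)"
        by (auto simp: P_def)
      then obtain n where n: "has_order (fst x $ j $ i) n"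
        unfolding dominates_def by blast
      then show ?thesis
        using has_order_quadratic[OF n d[unfolded dominates_iff[OF n]], of "- 1 - int k"]
        by (cases x) (simp add: transvection_conj_entries[OF ij] t_order_eq)
    qed
  qed (auto simp: P_def inj_def)
  have Q: "null (Q i j)" if ij: "i \<noteq> j" for i j
  proof (rule null_of_image[OF T[OF ij] _ P])
    show "1 \<in> (polys_in_t_inverse :: 'k laurent set)" "j \<noteq> i" "Q i j \<subseteq> carrier ?G"
      using ij by (auto simp: polys_in_t_inverse_iff lookup_one Q_def)
    show "transvection_conj i j 1 x \<in> P j i" if "x \<in> Q i j" for x
    proof -
      obtain M v where x: "x = (M, v)" by (cases x)
      from that obtain n where n: "has_order (M $ j $ j - M $ i $ i) n"
        "vanishes_below (M $ i $ j) (n + 1)" "vanishes_below (M $ j $ i) (n + 1)"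
        by (auto simp: Q_def x)
      have "has_order (M $ i $ j + 1 * (M $ j $ j - M $ i $ i) - 1 * 1 * M $ j $ i) n"
        "vanishes_below ((M $ i $ i + 1 * M $ j $ i) - (M $ j $ j - 1 * M $ j $ i)) n"
        "vanishes_below (M $ j $ i) n"
        using n unfolding has_order_def vanishes_below_def lookup_add lookup_minus mult_1 by auto
      moreover have "transvection_conj i j 1 x \<in> carrier ?G"
        using that T[OF ij] maps by (auto simp: Q_def polys_in_t_inverse_iff lookup_one)
      ultimately show ?thesis
        unfolding P_def dominates_def x using transvection_conj_entries[OF ij, of 1 M v] by auto
    qed
  qed
  have Z: "null Z"
  proof -
    have "Z \<subseteq> (\<lambda>c. (mat c, 0)) ` {c. c ^ 3 = 1}"
    proof
      fix x assume "x \<in> Z"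
      then obtain c where c: "x = (mat c, 0)" "det (mat c :: 'k laurent ^ 3 ^ 3) = 1"
        by (cases x) (auto simp: Z_def SL3_semidirect_simps special_linear_def)
      then have "c ^ 3 = 1"
        by (simp add: det_3 mat_def power3_eq_cube)
      with c show "x \<in> (\<lambda>c. (mat c, 0)) ` {c. c ^ 3 = 1}" by blast
    qed
    then have "finite Z"
      using finite_cube_roots_of_one finite_surj by blast
    then show ?thesis
      using finite_zero[of Z] by (auto simp: null_def Z_def)
  qed
  define I where "I = {(i :: 3, j :: 3). i \<noteq> j}"
  have "null ((\<Union>(i, j)\<in>I. V i j \<union> P i j \<union> Q i j) \<union> Z)"
    by (intro null_Un null_UN Z) (auto simp: I_def intro!: null_Un V P Q)
  moreover have "carrier ?G \<subseteq> (\<Union>(i, j)\<in>I. V i j \<union> P i j \<union> Q i j) \<union> Z"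
  proof
    have cover: "V i j \<union> P i j \<union> Q i j \<subseteq> (\<Union>(i, j)\<in>I. V i j \<union> P i j \<union> Q i j)" if "i \<noteq> j" for i j
      using that by (auto simp: I_def)
    fix x assume x: "x \<in> carrier ?G"
    obtain M v where Mv: "x = (M, v)" by (cases x)
    consider "v \<noteq> 0" | i j where "i \<noteq> j" "M $ i $ j \<noteq> 0 \<or> M $ i $ i \<noteq> M $ j $ j"
      | "v = 0" "\<And>i j. i \<noteq> j \<Longrightarrow> M $ i $ j = 0 \<and> M $ i $ i = M $ j $ j"
      by blast
    then show "x \<in> (\<Union>(i, j)\<in>I. V i j \<union> P i j \<union> Q i j) \<union> Z"
    proof cases
      case 1
      then obtain j where j: "v $ j \<noteq> 0" by (auto simp: vec_eq_iff)
      obtain i :: 3 where "i \<noteq> j" by (metis zero_neq_one)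
      have "x \<in> V i j \<or> x \<in> V j i"
        using dominates_total[OF j, of "v $ i"] x by (auto simp: V_def Mv)
      then show ?thesis
        using cover[of i j] cover[of j i] \<open>i \<noteq> j\<close> by blast
    next
      case 2
      let ?S = "{M $ i $ j, M $ j $ i, M $ j $ j - M $ i $ i}"
      obtain n where n: "\<forall>f\<in>?S. vanishes_below f n" "\<exists>f\<in>?S. has_order f n"
        using common_order[of ?S] 2(2) by auto
      have strict: "vanishes_below f (n + 1)" if "vanishes_below f n" "\<not> has_order f n"
        for f :: "'k laurent"
        using that zless_add1_eq[of _ n] by (auto simp: has_order_def vanishes_below_def)
      have "vanishes_below (M $ i $ i - M $ j $ j) n"
        using n(1) by (auto simp: vanishes_below_def lookup_minus)
      then have "x \<in> P i j" if "has_order (M $ j $ i) n"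
        using that n(1) x by (simp add: P_def Mv dominates_iff[OF that])
      moreover have "x \<in> P j i" if "has_order (M $ i $ j) n"
        using that n(1) x \<open>vanishes_below (M $ i $ i - M $ j $ j) n\<close>
        by (simp add: P_def Mv dominates_iff[OF that])
      moreover have "x \<in> Q i j" if "\<not> has_order (M $ j $ i) n" "\<not> has_order (M $ i $ j) n"
        using that n x strict by (auto simp: Q_def Mv)
      ultimately have "x \<in> P i j \<or> x \<in> P j i \<or> x \<in> Q i j"
        by blast
      then show ?thesis using cover[of i j] cover[of j i] 2(1) by blast
    next
      case 3
      have "M = mat (M $ 1 $ 1)"
      proof -
        have "M $ i $ i = M $ 1 $ 1" for i
          using 3(2)[of i 1] by (cases "i = 1") auto
        then show ?thesis
          using 3(2) by (simp add: vec_eq_iff mat_def)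
      qed
      then show ?thesis using 3(1) x by (auto simp: Z_def Mv)
    qed
  qed
  ultimately show False
    using null_subset not_null_carrier by blast
qed

section \<open>Generalized limits\<close>

locale generalized_limit =
  fixes L :: "(nat \<Rightarrow> complex) \<Rightarrow> complex"
  assumes L_add: "bounded (range s) \<Longrightarrow> bounded (range t) \<Longrightarrow> L (\<lambda>n. s n + t n) = L s + L t"
    and L_mult: "bounded (range s) \<Longrightarrow> L (\<lambda>n. c * s n) = c * L s"
    and L_closed: "bounded (range s) \<Longrightarrow> closed S \<Longrightarrow> range s \<subseteq> S \<Longrightarrow> L s \<in> S"
    and L_lim: "s \<longlonglongrightarrow> l \<Longrightarrow> L s = l"

text \<open>Evaluation at \<open>n\<close> is a point \<open>E n\<close> of a product of compact sets of complex numbers, one for each sequence.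
  By the theorem of Tychonoff these points accumulate at some \<open>L\<close>, and each property of \<open>L\<close> is
  inherited from the evaluations along a filter \<open>F\<close> that refines the sequence and converges to \<open>L\<close>.\<close>

lemma exists_generalized_limit: "\<exists>L. generalized_limit L"
proof -
  \<comment> \<open>Unbounded sequences get the value 0, so that each coordinate of \<open>E n\<close> stays in a compact set.\<close>
  define E :: "nat \<Rightarrow> (nat \<Rightarrow> complex) \<Rightarrow> complex"
    where "E n s = (if bounded (range s) then s n else 0)" for n s
  have "\<exists>K. compact K \<and> (\<forall>n. E n s \<in> K)" for s
  proof (cases "bounded (range s)")
    case True
    then show ?thesis
      by (intro exI[of _ "closure (range s)"]) (auto simp: E_def closure_subset[THEN subsetD])
  qed (auto simp: E_def intro: exI[of _ "{0}"])
  then obtain K where K: "\<And>s. compact (K s)" "\<And>n s. E n s \<in> K s"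
    by metis
  have "compact (PiE UNIV K)"
    using compactin_PiE[of "\<lambda>_. euclidean" UNIV K] K(1)
    by (simp add: euclidean_product_topology)
  moreover have "eventually (\<lambda>y. y \<in> PiE UNIV K) (filtermap E sequentially)"
    using K(2) by (simp add: eventually_filtermap PiE_iff)
  moreover have "filtermap E sequentially \<noteq> bot"
    by (simp add: filtermap_bot_iff)
  ultimately obtain L where L: "inf (nhds L) (filtermap E sequentially) \<noteq> bot"
    unfolding compact_filter by blast
  define F where "F = inf (nhds L) (filtermap E sequentially)"
  have F: "F \<noteq> bot" "F \<le> nhds L" "F \<le> filtermap E sequentially"
    using L by (auto simp: F_def)
  have ev: "eventually P F" if "eventually (\<lambda>n. P (E n)) sequentially" for P
    using that F(3) by (auto simp: le_filter_def eventually_filtermap)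
  have lim: "((\<lambda>y. y s) \<longlongrightarrow> L s) F" for s
  proof (rule topological_tendstoI)
    fix S assume S: "open S" "L s \<in> S"
    have "open ((\<lambda>y. y s) -` S)"
      using open_vimage[OF S(1) continuous_on_product_coordinates] .
    then have "eventually (\<lambda>y. y s \<in> S) (nhds L)"
      using S(2) eventually_nhds_in_open[of "(\<lambda>y. y s) -` S" L] by simp
    then show "eventually (\<lambda>y. y s \<in> S) F"
      using F(2) by (auto simp: le_filter_def)
  qed
  have unique: "L s = l" if "((\<lambda>y. y s) \<longlongrightarrow> l) F" for s l
    using tendsto_unique[OF F(1) lim that] .
  have "generalized_limit L"
  proof
    fix s t :: "nat \<Rightarrow> complex" assume st: "bounded (range s)" "bounded (range t)"
    have "bounded (range (\<lambda>n. s n + t n))"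
      using bounded_plus_comp[OF st] by simp
    then have "eventually (\<lambda>y. y s + y t = y (\<lambda>n. s n + t n)) F"
      using st by (intro ev) (simp add: E_def)
    then show "L (\<lambda>n. s n + t n) = L s + L t"
      by (rule unique[OF Lim_transform_eventually[OF tendsto_add[OF lim lim]]])
  next
    fix c :: complex and s :: "nat \<Rightarrow> complex" assume s: "bounded (range s)"
    have "bounded (range (\<lambda>n. c * s n))"
      using bounded_linear_image[OF s bounded_linear_mult_right[of c]] by (simp add: image_image)
    then have "eventually (\<lambda>y. c * y s = y (\<lambda>n. c * s n)) F"
      using s by (intro ev) (simp add: E_def)
    then show "L (\<lambda>n. c * s n) = c * L s"
      by (rule unique[OF Lim_transform_eventually[OF tendsto_mult[OF tendsto_const lim]]])
  next
    fix s :: "nat \<Rightarrow> complex" and S assume s: "bounded (range s)" "closed S" "range s \<subseteq> S"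
    have "eventually (\<lambda>y. y s \<in> S) F"
      using s by (intro ev always_eventually) (auto simp: E_def)
    then show "L s \<in> S"
      using Lim_in_closed_set[OF s(2) _ F(1) lim] by blast
  next
    fix s :: "nat \<Rightarrow> complex" and l assume s: "s \<longlonglongrightarrow> l"
    then have "bounded (range s)"
      by (rule convergent_imp_bounded)
    then have "((\<lambda>y. y s) \<longlongrightarrow> l) (filtermap E sequentially)"
      using s by (simp add: filterlim_filtermap E_def)
    then show "L s = l"
      using F(3) filterlim_mono unique by blast
  qed
  then show ?thesis by blast
qed

section \<open>Averages along growing finite sets\<close>

lemma linf_iff:
  "f \<in> carrier (linf G) \<longleftrightarrow> f \<in> extensional (carrier G) \<and> (\<exists>B. \<forall>x\<in>carrier G. cmod (f x) \<le> B)"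
  by (simp add: linf_def bounded_iff)

lemma linf_restrictI:
  "(\<And>x. x \<in> carrier G \<Longrightarrow> cmod (f x) \<le> B) \<Longrightarrow> (\<lambda>x\<in>carrier G. f x) \<in> carrier (linf G)"
  by (auto simp: linf_iff)

lemma coset_c0_iff:
  "e \<in> c0 G +>\<^bsub>linf G\<^esub> f \<longleftrightarrow> (\<exists>i\<in>c0 G. e = (\<lambda>x\<in>carrier G. i x + f x))"
  by (auto simp: a_r_coset_def' linf_def)

lemma c0_in_linf: "i \<in> c0 G \<Longrightarrow> i \<in> carrier (linf G)"
  by (simp add: c0_def)

lemma zero_in_c0: "(\<lambda>x\<in>carrier G. 0) \<in> c0 G"
  by (auto simp: c0_def linf_iff intro!: exI[of _ 0] finite_subset[of _ "{}"])

locale escaping_sequence = group G for G (structure) +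
  fixes F :: "nat \<Rightarrow> 'a set"
  assumes finite_F: "finite (F n)" and F_subset: "F n \<subseteq> carrier G"
    and card_F: "filterlim (\<lambda>n. card (F n)) at_top sequentially"
begin

definition average :: "nat \<Rightarrow> ('a \<Rightarrow> complex) \<Rightarrow> complex" where
  "average n f = (\<Sum>x\<in>F n. f x) / of_nat (card (F n))"

definition mean_abs :: "nat \<Rightarrow> ('a \<Rightarrow> complex) \<Rightarrow> real" where
  "mean_abs n f = (\<Sum>x\<in>F n. cmod (f x)) / card (F n)"

lemma average_cong: "(\<And>x. x \<in> carrier G \<Longrightarrow> f x = h x) \<Longrightarrow> average n f = average n h"
  using F_subset[of n] by (auto simp: average_def intro!: sum.cong arg_cong2[where f = divide])

lemma norm_average_le: "cmod (average n f) \<le> mean_abs n f"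
  by (simp add: average_def mean_abs_def norm_divide divide_right_mono sum_norm_le)

lemma norm_average_diff_le:
  assumes "\<And>x. x \<in> F n \<Longrightarrow> cmod (f x - h x) \<le> b x"
  shows "cmod (average n f - average n h) \<le> (\<Sum>x\<in>F n. b x) / card (F n)"
proof -
  have "cmod ((\<Sum>x\<in>F n. f x) - (\<Sum>x\<in>F n. h x)) \<le> (\<Sum>x\<in>F n. b x)"
    unfolding sum_subtractf[symmetric] by (rule sum_norm_le) (rule assms)
  then show ?thesis
    by (simp add: average_def norm_divide divide_right_mono flip: diff_divide_distrib)
qed

lemma norm_average_le_bound:
  assumes "\<And>x. x \<in> carrier G \<Longrightarrow> cmod (f x) \<le> B"
  shows "cmod (average n f) \<le> \<bar>B\<bar>"
proof -
  have "(\<Sum>x\<in>F n. cmod (f x)) \<le> card (F n) * \<bar>B\<bar>"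
    using F_subset[of n] assms by (intro sum_bounded_above) (meson abs_ge_self order_trans subsetD)
  then have "mean_abs n f \<le> \<bar>B\<bar>"
    by (simp add: mean_abs_def divide_le_eq mult.commute)
  then show ?thesis
    using norm_average_le order_trans by blast
qed

lemma bounded_averages:
  "f \<in> carrier (linf G) \<Longrightarrow> bounded (range (\<lambda>n. average n f))"
  unfolding linf_iff bounded_iff using norm_average_le_bound by blast

lemma real_card_F: "filterlim (\<lambda>n. real (card (F n))) at_top sequentially"
  using filterlim_compose[OF filterlim_real_sequentially card_F] .

text \<open>A function in \<open>c0\<close> is small off a finite set, whose share of \<open>F n\<close> tends to 0.\<close>

lemma mean_abs_c0:
  assumes i: "i \<in> c0 G"
  shows "(\<lambda>n. mean_abs n i) \<longlonglongrightarrow> 0"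
proof (rule tendstoI)
  fix e :: real assume e: "0 < e"
  define K where "K = {x \<in> carrier G. e / 2 \<le> cmod (i x)}"
  have K: "finite K"
  proof -
    have "finite {x \<in> carrier G. \<epsilon> \<le> cmod (i x)}" if "0 < \<epsilon>" for \<epsilon>
      using i that by (simp add: c0_def)
    from this[of "e / 2"] show ?thesis
      using e by (simp only: K_def half_gt_zero) 
  qed
  obtain B where B: "\<And>x. x \<in> carrier G \<Longrightarrow> cmod (i x) \<le> B"
    using c0_in_linf[OF i] by (auto simp: linf_iff)
  have bound: "(\<Sum>x\<in>F n. cmod (i x)) \<le> \<bar>B\<bar> * card K + card (F n) * (e / 2)" for n
  proof -
    have "(\<Sum>x\<in>F n. cmod (i x)) \<le> (\<Sum>x\<in>F n. (if x \<in> K then \<bar>B\<bar> else 0) + e / 2)"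
    proof (rule sum_mono)
      fix x assume "x \<in> F n"
      then have "x \<in> carrier G" using F_subset by blast
      then show "cmod (i x) \<le> (if x \<in> K then \<bar>B\<bar> else 0) + e / 2"
        using B[of x] e by (auto simp: K_def)
    qed
    also have "\<dots> = \<bar>B\<bar> * card (F n \<inter> K) + card (F n) * (e / 2)"
      using finite_F[of n] by (simp add: sum.distrib sum.If_cases)
    also have "\<bar>B\<bar> * card (F n \<inter> K) \<le> \<bar>B\<bar> * card K"
      using K by (intro mult_left_mono) (auto intro: card_mono)
    finally show ?thesis by simp
  qed
  have "eventually (\<lambda>n. real (card (F n)) > 2 * \<bar>B\<bar> * card K / e) sequentially"
    using real_card_F by (simp add: filterlim_at_top_dense)
  then show "eventually (\<lambda>n. dist (mean_abs n i) 0 < e) sequentially"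
  proof (rule eventually_mono)
    fix n assume n: "real (card (F n)) > 2 * \<bar>B\<bar> * card K / e"
    then have pos: "real (card (F n)) > 0"
      using e by (smt (verit) divide_nonneg_pos mult_nonneg_nonneg of_nat_0_le_iff)
    from n have "\<bar>B\<bar> * card K < card (F n) * (e / 2)"
      using e by (simp add: field_simps)
    with bound[of n] have "(\<Sum>x\<in>F n. cmod (i x)) < card (F n) * e"
      by (simp add: field_simps)
    then have "mean_abs n i < e"
      using pos by (simp add: mean_abs_def divide_less_eq mult.commute)
    moreover have "0 \<le> mean_abs n i"
      by (simp add: mean_abs_def sum_nonneg)
    ultimately show "dist (mean_abs n i) 0 < e" by simp
  qed
qed

lemma sum_mean_abs:
  "(\<Sum>x\<in>F n. \<Sum>i\<in>I. cmod (d i x)) / card (F n) = (\<Sum>i\<in>I. mean_abs n (d i))"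
  unfolding mean_abs_def by (subst sum.swap) (simp only: sum_divide_distrib)

text \<open>Left translation of \<open>F n\<close> by \<open>g\<close> is, up to a permutation of \<open>F n\<close>, right translation by
  finitely many elements that do not depend on \<open>n\<close>. A function \<open>f\<close> that is invariant under right translation modulo
  \<open>c0\<close> changes under each of them by an element of \<open>c0\<close>, whose averages over \<open>F n\<close> tend to 0.
  Hence a generalized limit of the averages is a left-invariant state.\<close>

lemma not_properly_proximal:
  assumes quasi: "\<And>g. g \<in> carrier G \<Longrightarrow> \<exists>R. finite R \<and> R \<subseteq> carrier G \<and>
    (\<forall>n. \<exists>\<sigma>. bij_betw \<sigma> (F n) (F n) \<and> (\<forall>x\<in>F n. \<exists>r\<in>R. g \<otimes> x = \<sigma> x \<otimes> r))"
  shows "\<not> properly_proximal G"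
proof -
  obtain L where L: "generalized_limit L"
    using exists_generalized_limit by blast
  interpret generalized_limit L by (rule L)
  define \<psi> where "\<psi> f = L (\<lambda>n. average n f)" for f
  \<comment> \<open>This is well defined on cosets of \<open>c0\<close>: the fact \<open>coset\<close> below shows that \<open>\<psi>\<close> is constant on each of them.\<close>
  define \<phi> where "\<phi> E = \<psi> (SOME f. f \<in> E)" for E
  have \<psi>_eqI: "\<psi> f = \<psi> h"
    if "f \<in> carrier (linf G)" "h \<in> carrier (linf G)"
      and lim: "(\<lambda>n. average n f - average n h) \<longlonglongrightarrow> 0" for f h
  proof -
    have "\<psi> f = L (\<lambda>n. average n h + (average n f - average n h))"
      by (simp add: \<psi>_def)
    also have "\<dots> = \<psi> h + 0"
      using L_add[OF bounded_averages[OF that(2)] convergent_imp_bounded[OF lim]]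
      unfolding L_lim[OF lim] \<psi>_def .
    finally show ?thesis by simp
  qed
  have \<psi>_eq_c0: "\<psi> f = \<psi> h"
    if f: "f \<in> carrier (linf G)" and h: "h \<in> carrier (linf G)" and I: "finite I" "\<And>i. i \<in> I \<Longrightarrow> d i \<in> c0 G"
      and close: "\<And>x. x \<in> carrier G \<Longrightarrow> cmod (f x - h x) \<le> B * (\<Sum>i\<in>I. cmod (d i x))"
    for f h and I :: "nat set" and d B
  proof (rule \<psi>_eqI[OF f h])
    have bound: "cmod (average n f - average n h) \<le> B * (\<Sum>i\<in>I. mean_abs n (d i))" for n
    proof -
      have "cmod (average n f - average n h) \<le> (\<Sum>x\<in>F n. B * (\<Sum>i\<in>I. cmod (d i x))) / card (F n)"
        by (rule norm_average_diff_le, rule close, rule subsetD[OF F_subset])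
      also have "\<dots> = B * ((\<Sum>x\<in>F n. \<Sum>i\<in>I. cmod (d i x)) / card (F n))"
        by (simp only: sum_distrib_left[symmetric] times_divide_eq_right)
      finally show ?thesis
        by (simp only: sum_mean_abs)
    qed
    have "(\<lambda>n. B * (\<Sum>i\<in>I. mean_abs n (d i))) \<longlonglongrightarrow> B * (\<Sum>i\<in>I. 0)"
      by (rule tendsto_mult_left, rule tendsto_sum, rule mean_abs_c0, rule I(2))
    then have "(\<lambda>n. B * (\<Sum>i\<in>I. mean_abs n (d i))) \<longlonglongrightarrow> 0"
      by simp
    then show "(\<lambda>n. average n f - average n h) \<longlonglongrightarrow> 0"
      by (rule Lim_null_comparison[OF always_eventually[OF allI[OF bound]]])
  qed
  have \<phi>_choice: "\<exists>e\<in>E. \<phi> E = \<psi> e" if "f \<in> E" for E f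
    using that someI[of "\<lambda>f. f \<in> E" f] by (auto simp: \<phi>_def)
  have \<psi>_left: "\<psi> (left_translate G g a) = \<psi> a"
    if a: "a \<in> carrier (linf G)" and g: "g \<in> carrier G"
      and inv: "\<And>r. r \<in> carrier G \<Longrightarrow> \<exists>i\<in>c0 G. \<exists>j\<in>c0 G. \<forall>x\<in>carrier G. cmod (a (x \<otimes> r) - a x) \<le> cmod (i x) + cmod (j x)"
    for a g
  proof (rule \<psi>_eqI[OF _ a])
    obtain B where B: "\<And>x. x \<in> carrier G \<Longrightarrow> cmod (a x) \<le> B"
      using a by (auto simp: linf_iff)
    show "left_translate G g a \<in> carrier (linf G)"
      unfolding left_translate_def using g by (intro linf_restrictI[of _ _ B] B) auto
    obtain R where R: "finite R" "R \<subseteq> carrier G" and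
      "\<forall>n. \<exists>\<sigma>. bij_betw \<sigma> (F n) (F n) \<and> (\<forall>x\<in>F n. \<exists>r\<in>R. inv g \<otimes> x = \<sigma> x \<otimes> r)"
      using quasi[of "inv g"] g by auto
    then obtain \<sigma> where \<sigma>: "\<And>n. bij_betw (\<sigma> n) (F n) (F n)"
      "\<And>n x. x \<in> F n \<Longrightarrow> \<exists>r\<in>R. inv g \<otimes> x = \<sigma> n x \<otimes> r"
      by metis
    have "\<forall>r\<in>R. \<exists>i j. i \<in> c0 G \<and> j \<in> c0 G \<and>
        (\<forall>x\<in>carrier G. cmod (a (x \<otimes> r) - a x) \<le> cmod (i x) + cmod (j x))"
      using inv R(2) by blast
    then obtain i j where ij: "\<And>r. r \<in> R \<Longrightarrow> i r \<in> c0 G" "\<And>r. r \<in> R \<Longrightarrow> j r \<in> c0 G"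
      "\<And>r x. r \<in> R \<Longrightarrow> x \<in> carrier G \<Longrightarrow> cmod (a (x \<otimes> r) - a x) \<le> cmod (i r x) + cmod (j r x)"
      by metis
    have bound: "cmod (average n (left_translate G g a) - average n a)
        \<le> (\<Sum>r\<in>R. mean_abs n (i r) + mean_abs n (j r))" for n
    proof -
      define D where "D y = (\<Sum>r\<in>R. cmod (i r y) + cmod (j r y))" for y
      have "average n a = average n (\<lambda>x. a (\<sigma> n x))"
        by (simp add: average_def sum.reindex_bij_betw[OF \<sigma>(1), of a])
      moreover have "cmod (left_translate G g a x - a (\<sigma> n x)) \<le> D (\<sigma> n x)" if x: "x \<in> F n" for x
      proof -
        obtain r where r: "r \<in> R" "inv g \<otimes> x = \<sigma> n x \<otimes> r"
          using \<sigma>(2)[OF x] by blast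
        have "\<sigma> n x \<in> carrier G" "x \<in> carrier G"
          using bij_betwE[OF \<sigma>(1)] x F_subset by blast+
        then have "cmod (left_translate G g a x - a (\<sigma> n x)) \<le> cmod (i r (\<sigma> n x)) + cmod (j r (\<sigma> n x))"
          using ij(3)[OF r(1)] by (simp add: left_translate_def r(2))
        also have "\<dots> \<le> D (\<sigma> n x)"
          unfolding D_def using r(1) R(1) by (intro member_le_sum) auto
        finally show ?thesis .
      qed
      ultimately have "cmod (average n (left_translate G g a) - average n a)
          \<le> (\<Sum>x\<in>F n. D (\<sigma> n x)) / card (F n)"
        using norm_average_diff_le[of n "left_translate G g a" "\<lambda>x. a (\<sigma> n x)"] by simp
      also have "(\<Sum>x\<in>F n. D (\<sigma> n x)) = (\<Sum>y\<in>F n. D y)"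
        by (rule sum.reindex_bij_betw[OF \<sigma>(1)])
      also have "\<dots> / card (F n) = (\<Sum>r\<in>R. mean_abs n (i r) + mean_abs n (j r))"
        by (simp only: D_def sum.distrib add_divide_distrib sum_mean_abs)
      finally show ?thesis .
    qed
    have "(\<lambda>n. \<Sum>r\<in>R. mean_abs n (i r) + mean_abs n (j r)) \<longlonglongrightarrow> (\<Sum>r\<in>R. 0 + 0)"
      by (rule tendsto_sum, rule tendsto_add; rule mean_abs_c0, rule ij)
    then have "(\<lambda>n. \<Sum>r\<in>R. mean_abs n (i r) + mean_abs n (j r)) \<longlonglongrightarrow> 0"
      by simp
    then show "(\<lambda>n. average n (left_translate G g a) - average n a) \<longlonglongrightarrow> 0"
      by (rule Lim_null_comparison[OF always_eventually[OF allI[OF bound]]])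
  qed
  let ?A = "right_invariants G"
  have carrier: "\<exists>f\<in>carrier (linf G). E = c0 G +>\<^bsub>linf G\<^esub> f" "\<And>g. g \<in> carrier G \<Longrightarrow> right_translate G g ` E = E"
    if "E \<in> carrier ?A" for E
    using that by (auto simp: right_invariants_def linf_mod_c0_def FactRing_def Let_def A_RCOSETS_def')
  have coset: "e \<in> carrier (linf G)" "\<psi> e = \<psi> f"
    if f: "f \<in> carrier (linf G)" and e: "e \<in> c0 G +>\<^bsub>linf G\<^esub> f" for e f
  proof -
    obtain i where i: "i \<in> c0 G" "e = (\<lambda>x\<in>carrier G. i x + f x)"
      using e by (auto simp: coset_c0_iff)
    obtain B where B: "\<And>x. x \<in> carrier G \<Longrightarrow> cmod (f x) \<le> B"
      using f by (auto simp: linf_iff)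
    obtain C where C: "\<And>x. x \<in> carrier G \<Longrightarrow> cmod (i x) \<le> C"
      using c0_in_linf[OF i(1)] by (auto simp: linf_iff)
    show e': "e \<in> carrier (linf G)"
      unfolding i(2) using B C by (intro linf_restrictI[of _ _ "C + B"] norm_triangle_mono) auto
    show "\<psi> e = \<psi> f"
      by (rule \<psi>_eq_c0[OF e' f, of "{0}" "\<lambda>_. i" 1]) (auto simp: i)
  qed
  have self: "f \<in> c0 G +>\<^bsub>linf G\<^esub> f" if "f \<in> carrier (linf G)" for f
    unfolding coset_c0_iff
    by (rule bexI[OF _ zero_in_c0]) (use that in \<open>auto simp: linf_iff extensional_def\<close>)
  have \<phi>_coset: "\<phi> (c0 G +>\<^bsub>linf G\<^esub> f) = \<psi> f" if "f \<in> carrier (linf G)" for f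
    using \<phi>_choice[OF self[OF that]] coset[OF that] by auto
  have add_linf: "(\<lambda>x\<in>carrier G. a x + b x) \<in> carrier (linf G)"
    and \<psi>_add: "\<psi> (\<lambda>x\<in>carrier G. a x + b x) = \<psi> a + \<psi> b"
    if ab: "a \<in> carrier (linf G)" "b \<in> carrier (linf G)" for a b
  proof -
    obtain B C where BC: "\<And>x. x \<in> carrier G \<Longrightarrow> cmod (a x) \<le> B" "\<And>x. x \<in> carrier G \<Longrightarrow> cmod (b x) \<le> C"
      using ab by (auto simp: linf_iff)
    show "(\<lambda>x\<in>carrier G. a x + b x) \<in> carrier (linf G)"
      by (rule linf_restrictI[of _ _ "B + C"]) (auto intro: norm_triangle_mono BC)
    have "average n (\<lambda>x\<in>carrier G. a x + b x) = average n (\<lambda>x. a x + b x)" for n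
      by (rule average_cong) simp
    also have "average n (\<lambda>x. a x + b x) = average n a + average n b" for n
      by (simp add: average_def sum.distrib add_divide_distrib)
    finally have "\<psi> (\<lambda>x\<in>carrier G. a x + b x) = L (\<lambda>n. average n a + average n b)"
      unfolding \<psi>_def by simp
    also have "\<dots> = \<psi> a + \<psi> b"
      unfolding \<psi>_def by (rule L_add[OF bounded_averages[OF ab(1)] bounded_averages[OF ab(2)]])
    finally show "\<psi> (\<lambda>x\<in>carrier G. a x + b x) = \<psi> a + \<psi> b" .
  qed
  have mult_linf: "(\<lambda>x\<in>carrier G. a x * b x) \<in> carrier (linf G)"
    if ab: "a \<in> carrier (linf G)" "b \<in> carrier (linf G)" for a b
  proof -
    obtain B C where BC: "\<And>x. x \<in> carrier G \<Longrightarrow> cmod (a x) \<le> B" "\<And>x. x \<in> carrier G \<Longrightarrow> cmod (b x) \<le> C"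
      using ab by (auto simp: linf_iff)
    show ?thesis
    proof (rule linf_restrictI)
      fix x assume "x \<in> carrier G"
      from BC[OF this] show "cmod (a x * b x) \<le> B * C"
        unfolding norm_mult by (intro mult_mono) (auto intro: order_trans[OF norm_ge_zero])
    qed
  qed
  have \<psi>_scale: "\<psi> (\<lambda>x\<in>carrier G. c * b x) = c * \<psi> b" if b: "b \<in> carrier (linf G)" for b c
  proof -
    have "average n (\<lambda>x\<in>carrier G. c * b x) = average n (\<lambda>x. c * b x)" for n
      by (rule average_cong) simp
    also have "average n (\<lambda>x. c * b x) = c * average n b" for n
      by (simp add: average_def flip: sum_distrib_left)
    finally have "\<psi> (\<lambda>x\<in>carrier G. c * b x) = L (\<lambda>n. c * average n b)"
      unfolding \<psi>_def by simp
    also have "\<dots> = c * \<psi> b"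
      unfolding \<psi>_def by (rule L_mult[OF bounded_averages[OF b]])
    finally show ?thesis .
  qed
  have const_linf: "(\<lambda>x\<in>carrier G. c) \<in> carrier (linf G)" for c
    by (rule linf_restrictI[of _ _ "cmod c"]) simp
  have \<psi>_one: "\<psi> (\<lambda>x\<in>carrier G. 1) = 1"
  proof -
    have "average n (\<lambda>x\<in>carrier G. 1) = average n (\<lambda>x. 1)" for n
      by (rule average_cong) simp
    then have "1 = average n (\<lambda>x\<in>carrier G. 1)" if "0 < card (F n)" for n
      using that by (auto simp: average_def)
    moreover have "eventually (\<lambda>n. 0 < card (F n)) sequentially"
      using real_card_F[unfolded filterlim_at_top_dense, THEN spec[of _ 0]] by simp
    ultimately have "(\<lambda>n. average n (\<lambda>x\<in>carrier G. 1)) \<longlonglongrightarrow> 1"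
      by (intro Lim_transform_eventually[OF tendsto_const]) (auto elim: eventually_mono)
    then show ?thesis
      unfolding \<psi>_def by (rule L_lim)
  qed
  have \<psi>_pos: "\<psi> (\<lambda>x\<in>carrier G. cnj (b x) * b x) \<in> \<real>\<^sub>\<ge>\<^sub>0"
    if "(\<lambda>x\<in>carrier G. cnj (b x) * b x) \<in> carrier (linf G)" for b
    unfolding \<psi>_def
  proof (rule L_closed[OF bounded_averages[OF that] closed_nonneg_Reals_complex image_subsetI])
    fix n
    have "average n (\<lambda>x\<in>carrier G. cnj (b x) * b x) = average n (\<lambda>x. complex_of_real ((cmod (b x))\<^sup>2))"
      by (rule average_cong) (simp add: complex_norm_square mult.commute del: of_real_power)
    also have "\<dots> = complex_of_real ((\<Sum>x\<in>F n. (cmod (b x))\<^sup>2) / card (F n))"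
      by (simp add: average_def)
    finally show "average n (\<lambda>x\<in>carrier G. cnj (b x) * b x) \<in> \<real>\<^sub>\<ge>\<^sub>0"
      by (simp only: nonneg_Reals_of_real_iff) (simp add: sum_nonneg)
  qed
  have mult_iff: "e \<in> X \<otimes>\<^bsub>?A\<^esub> Y \<longleftrightarrow> (\<exists>a\<in>X. \<exists>b\<in>Y. e \<in> c0 G +>\<^bsub>linf G\<^esub> (\<lambda>x\<in>carrier G. a x * b x))" for e X Y
    by (simp add: right_invariants_def linf_mod_c0_def FactRing_def Let_def rcoset_mult_def linf_def[THEN arg_cong, of mult])
  have smult_eq: "c \<odot>\<^bsub>?A\<^esub> X = (c0 G +>\<^bsub>linf G\<^esub> (\<lambda>x\<in>carrier G. c)) \<otimes>\<^bsub>?A\<^esub> X" for c X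
  proof -
    have "c \<odot>\<^bsub>linf G\<^esub> \<one>\<^bsub>linf G\<^esub> = (\<lambda>x\<in>carrier G. c)"
      by (auto simp: linf_def)
    then show ?thesis
      by (simp add: right_invariants_def linf_mod_c0_def Let_def)
  qed
  have add_iff: "e \<in> X \<oplus>\<^bsub>?A\<^esub> Y \<longleftrightarrow> (\<exists>a\<in>X. \<exists>b\<in>Y. e = (\<lambda>x\<in>carrier G. a x + b x))" for e X Y
    by (auto simp: right_invariants_def linf_mod_c0_def FactRing_def Let_def set_add_def' linf_def[THEN arg_cong, of add])
  have one_eq: "\<one>\<^bsub>?A\<^esub> = c0 G +>\<^bsub>linf G\<^esub> (\<lambda>x\<in>carrier G. 1)"
    by (simp add: right_invariants_def linf_mod_c0_def FactRing_def Let_def linf_def[THEN arg_cong, of one])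
  have star_eq: "star ?A X = (\<lambda>f. \<lambda>x\<in>carrier G. cnj (f x)) ` X" for X
    by (simp add: right_invariants_def linf_mod_c0_def Let_def linf_def[THEN arg_cong, of star])
  have bound_linf: "\<exists>B\<ge>0. \<forall>x\<in>carrier G. cmod (b x) \<le> B" if "b \<in> carrier (linf G)" for b
    using that unfolding linf_iff by (meson abs_ge_self abs_ge_zero order_trans)
  have "is_state ?A \<phi>"
    unfolding is_state_def
  proof (intro conjI ballI allI)
    fix X Y assume "X \<in> carrier ?A" "Y \<in> carrier ?A"
    then obtain f h where f: "f \<in> carrier (linf G)" "X = c0 G +>\<^bsub>linf G\<^esub> f"
      and h: "h \<in> carrier (linf G)" "Y = c0 G +>\<^bsub>linf G\<^esub> h"
      using carrier(1) by metis
    have \<phi>X: "\<phi> X = \<psi> f" and \<phi>Y: "\<phi> Y = \<psi> h"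
      using \<phi>_coset f h by simp_all
    have "(\<lambda>x\<in>carrier G. f x + h x) \<in> X \<oplus>\<^bsub>?A\<^esub> Y"
      unfolding add_iff using self f h by blast
    then obtain e where "e \<in> X \<oplus>\<^bsub>?A\<^esub> Y" and e: "\<phi> (X \<oplus>\<^bsub>?A\<^esub> Y) = \<psi> e"
      using \<phi>_choice by blast
    then obtain a b where ab: "a \<in> X" "b \<in> Y" "e = (\<lambda>x\<in>carrier G. a x + b x)"
      unfolding add_iff by blast
    note a = coset[OF f(1) ab(1)[unfolded f(2)]] and b = coset[OF h(1) ab(2)[unfolded h(2)]]
    show "\<phi> (X \<oplus>\<^bsub>?A\<^esub> Y) = \<phi> X + \<phi> Y"
      unfolding e ab(3) \<psi>_add[OF a(1) b(1)] a(2) b(2) \<phi>X \<phi>Y ..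
  next
    fix c X assume "X \<in> carrier ?A"
    then obtain f where f: "f \<in> carrier (linf G)" "X = c0 G +>\<^bsub>linf G\<^esub> f"
      using carrier(1) by metis
    have \<phi>X: "\<phi> X = \<psi> f"
      using \<phi>_coset f by simp
    have "(\<lambda>x\<in>carrier G. (\<lambda>x\<in>carrier G. c) x * f x) \<in> c \<odot>\<^bsub>?A\<^esub> X"
      unfolding smult_eq mult_iff
      by (rule bexI[of _ "\<lambda>x\<in>carrier G. c"], rule bexI[of _ f])
        (simp_all only: f self mult_linf const_linf)
    then obtain e where "e \<in> c \<odot>\<^bsub>?A\<^esub> X" and e: "\<phi> (c \<odot>\<^bsub>?A\<^esub> X) = \<psi> e"
      using \<phi>_choice by blast
    then obtain a b where ab: "a \<in> c0 G +>\<^bsub>linf G\<^esub> (\<lambda>x\<in>carrier G. c)" "b \<in> X"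
      "e \<in> c0 G +>\<^bsub>linf G\<^esub> (\<lambda>x\<in>carrier G. a x * b x)"
      unfolding smult_eq mult_iff by blast
    note a = coset[OF const_linf ab(1)] and b = coset[OF f(1) ab(2)[unfolded f(2)]]
    obtain i where i: "i \<in> c0 G" "a = (\<lambda>x\<in>carrier G. i x + (\<lambda>x\<in>carrier G. c) x)"
      using ab(1) unfolding coset_c0_iff by blast
    obtain B where B: "B \<ge> 0" "\<And>x. x \<in> carrier G \<Longrightarrow> cmod (b x) \<le> B"
      using bound_linf[OF b(1)] by blast
    have "\<psi> (\<lambda>x\<in>carrier G. a x * b x) = \<psi> (\<lambda>x\<in>carrier G. (\<lambda>x\<in>carrier G. c) x * b x)"
    proof (rule \<psi>_eq_c0[OF mult_linf[OF a(1) b(1)] mult_linf[OF const_linf[of c] b(1)], of "{0}" "\<lambda>_. i" B])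
      fix x assume x: "x \<in> carrier G"
      then have "a x * b x - c * b x = b x * i x"
        by (simp add: i(2) algebra_simps)
      then have "cmod (a x * b x - c * b x) = cmod (b x) * cmod (i x)"
        by (simp add: norm_mult)
      also have "\<dots> \<le> B * cmod (i x)"
        using B(2)[OF x] by (rule mult_right_mono) simp
      finally show "cmod ((\<lambda>x\<in>carrier G. a x * b x) x - (\<lambda>x\<in>carrier G. (\<lambda>x\<in>carrier G. c) x * b x) x)
          \<le> B * (\<Sum>k\<in>{0::nat}. cmod (i x))"
        using x by simp
    qed (use i(1) in auto)
    also have "(\<lambda>x\<in>carrier G. (\<lambda>x\<in>carrier G. c) x * b x) = (\<lambda>x\<in>carrier G. c * b x)"
      by (rule restrict_ext) simp
    finally show "\<phi> (c \<odot>\<^bsub>?A\<^esub> X) = c * \<phi> X"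
      unfolding e coset(2)[OF mult_linf[OF a(1) b(1)] ab(3)] \<psi>_scale[OF b(1)] b(2) \<phi>X .
  next
    fix X assume "X \<in> carrier ?A"
    then obtain f where f: "f \<in> carrier (linf G)" "X = c0 G +>\<^bsub>linf G\<^esub> f"
      using carrier(1) by metis
    have star_linf: "(\<lambda>x\<in>carrier G. cnj (a x)) \<in> carrier (linf G)" if "a \<in> carrier (linf G)" for a
      using that by (auto simp: linf_iff)
    have "(\<lambda>x\<in>carrier G. (\<lambda>x\<in>carrier G. cnj (f x)) x * f x) \<in> star ?A X \<otimes>\<^bsub>?A\<^esub> X"
      unfolding star_eq mult_iff
      by (rule bexI[of _ "\<lambda>x\<in>carrier G. cnj (f x)"], rule bexI[of _ f], rule self,
          rule mult_linf[OF star_linf[OF f(1)] f(1)], unfold f(2), rule self[OF f(1)],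
          rule image_eqI[OF refl self[OF f(1)]])
    then obtain e where "e \<in> star ?A X \<otimes>\<^bsub>?A\<^esub> X" and e: "\<phi> (star ?A X \<otimes>\<^bsub>?A\<^esub> X) = \<psi> e"
      using \<phi>_choice by blast
    then obtain a b where ab: "a \<in> X" "b \<in> X"
      "e \<in> c0 G +>\<^bsub>linf G\<^esub> (\<lambda>x\<in>carrier G. (\<lambda>x\<in>carrier G. cnj (a x)) x * b x)"
      unfolding star_eq mult_iff by blast
    note a = coset[OF f(1) ab(1)[unfolded f(2)]] and b = coset[OF f(1) ab(2)[unfolded f(2)]]
    obtain i j where i: "i \<in> c0 G" "a = (\<lambda>x\<in>carrier G. i x + f x)" and j: "j \<in> c0 G" "b = (\<lambda>x\<in>carrier G. j x + f x)"
      using ab(1,2) unfolding f(2) coset_c0_iff by blast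
    obtain B where B: "B \<ge> 0" "\<And>x. x \<in> carrier G \<Longrightarrow> cmod (b x) \<le> B"
      using bound_linf[OF b(1)] by blast
    have "\<psi> (\<lambda>x\<in>carrier G. (\<lambda>x\<in>carrier G. cnj (a x)) x * b x)
        = \<psi> (\<lambda>x\<in>carrier G. (\<lambda>x\<in>carrier G. cnj (b x)) x * b x)"
    proof (rule \<psi>_eq_c0[OF mult_linf[OF star_linf[OF a(1)] b(1)] mult_linf[OF star_linf[OF b(1)] b(1)],
          of "{0, 1}" "\<lambda>k. if k = 0 then i else j" B])
      fix x assume x: "x \<in> carrier G"
      then have "cnj (a x) * b x - cnj (b x) * b x = b x * cnj (i x - j x)"
        by (simp add: i(2) j(2) algebra_simps)
      then have "cmod (cnj (a x) * b x - cnj (b x) * b x) = cmod (b x) * cmod (i x - j x)"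
        by (simp only: norm_mult complex_mod_cnj)
      also have "\<dots> \<le> B * (cmod (i x) + cmod (j x))"
        using B(2)[OF x] B(1) by (intro mult_mono norm_triangle_ineq4) auto
      finally show "cmod ((\<lambda>x\<in>carrier G. (\<lambda>x\<in>carrier G. cnj (a x)) x * b x) x
          - (\<lambda>x\<in>carrier G. (\<lambda>x\<in>carrier G. cnj (b x)) x * b x) x)
          \<le> B * (\<Sum>k\<in>{0::nat, 1}. cmod ((if k = 0 then i else j) x))"
        using x by simp
    qed (use i(1) j(1) in auto)
    also have "(\<lambda>x\<in>carrier G. (\<lambda>x\<in>carrier G. cnj (b x)) x * b x) = (\<lambda>x\<in>carrier G. cnj (b x) * b x)"
      by (rule restrict_ext) simp
    also have "\<psi> (\<lambda>x\<in>carrier G. cnj (b x) * b x) \<in> \<real>\<^sub>\<ge>\<^sub>0"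
    proof (rule \<psi>_pos)
      show "(\<lambda>x\<in>carrier G. cnj (b x) * b x) \<in> carrier (linf G)"
        using mult_linf[OF star_linf[OF b(1)] b(1)] by (simp cong: restrict_cong)
    qed
    finally show "\<phi> (star ?A X \<otimes>\<^bsub>?A\<^esub> X) \<in> \<real>\<^sub>\<ge>\<^sub>0"
      unfolding e coset(2)[OF mult_linf[OF star_linf[OF a(1)] b(1)] ab(3)] .
  next
    show "\<phi> \<one>\<^bsub>?A\<^esub> = 1"
      unfolding one_eq \<phi>_coset[OF const_linf] by (rule \<psi>_one)
  qed
  moreover have left: "\<phi> (left_translate G g ` X) = \<phi> X" if g: "g \<in> carrier G" and X: "X \<in> carrier ?A" for g X
  proof -
    obtain f where f: "f \<in> carrier (linf G)" "X = c0 G +>\<^bsub>linf G\<^esub> f"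
      using carrier(1)[OF X] by blast
    have \<phi>X: "\<phi> X = \<psi> f"
      using \<phi>_coset f by simp
    have "left_translate G g f \<in> left_translate G g ` X"
      unfolding f(2) by (rule imageI[OF self[OF f(1)]])
    from \<phi>_choice[OF this] obtain a where a: "a \<in> X"
      and e: "\<phi> (left_translate G g ` X) = \<psi> (left_translate G g a)"
      by auto
    note a' = coset[OF f(1) a[unfolded f(2)]]
    have "\<psi> (left_translate G g a) = \<psi> a"
    proof (rule \<psi>_left[OF a'(1) g])
      fix r assume r: "r \<in> carrier G"
      have "right_translate G r a \<in> X"
        using imageI[OF a, of "right_translate G r"] unfolding carrier(2)[OF X r] .
      then obtain i where i: "i \<in> c0 G" "right_translate G r a = (\<lambda>x\<in>carrier G. i x + f x)"
        unfolding f(2) coset_c0_iff by blast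
      obtain j where j: "j \<in> c0 G" "a = (\<lambda>x\<in>carrier G. j x + f x)"
        using a unfolding f(2) coset_c0_iff by blast
      have "cmod (a (x \<otimes> r) - a x) \<le> cmod (i x) + cmod (j x)" if x: "x \<in> carrier G" for x
      proof -
        have "a (x \<otimes> r) = i x + f x"
          using fun_cong[OF i(2), of x] x by (simp add: right_translate_def)
        moreover have "a x = j x + f x"
          using x by (simp add: j(2))
        ultimately show ?thesis
          using norm_triangle_ineq4[of "i x" "j x"] by simp
      qed
      then show "\<exists>i\<in>c0 G. \<exists>j\<in>c0 G. \<forall>x\<in>carrier G. cmod (a (x \<otimes> r) - a x) \<le> cmod (i x) + cmod (j x)"
        using i(1) j(1) by blast
    qed
    then show ?thesis
      unfolding e a'(2) \<phi>X .
  qed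
  ultimately show ?thesis
    unfolding properly_proximal_def not_not by (intro exI[of _ \<phi>] conjI ballI)
qed

end

section \<open>Failure of proper proximality\<close>

definition laurent_vectors :: "int set \<Rightarrow> ('k::field laurent ^ 3) set" where
  "laurent_vectors S = {v. \<forall>i. Poly_Mapping.keys (v $ i) \<subseteq> S}"

lemma finite_laurent_vectors:
  assumes "finite (UNIV :: 'k::field set)" "finite S"
  shows "finite (laurent_vectors S :: ('k laurent ^ 3) set)"
proof (rule inj_on_finite)
  let ?c = "\<lambda>v :: 'k laurent ^ 3. \<lambda>(i, n). Poly_Mapping.lookup (v $ i) n"
  show "inj_on ?c (laurent_vectors S)"
    by (intro inj_onI) (auto simp: vec_eq_iff poly_mapping_eq_iff fun_eq_iff)
  show "?c ` laurent_vectors S \<subseteq> {f. \<forall>x. (x \<in> UNIV \<times> S \<longrightarrow> f x \<in> UNIV) \<and> (x \<notin> UNIV \<times> S \<longrightarrow> f x = 0)}"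
    by (auto simp: laurent_vectors_def subset_iff in_keys_iff)
  show "finite {f :: 3 \<times> int \<Rightarrow> 'k. \<forall>x. (x \<in> UNIV \<times> S \<longrightarrow> f x \<in> UNIV) \<and> (x \<notin> UNIV \<times> S \<longrightarrow> f x = 0)}"
    by (rule finite_set_of_finite_funs) (use assms in auto)
qed

lemma laurent_vectors_mult:
  assumes A: "\<And>i j. Poly_Mapping.keys (A $ i $ j) \<subseteq> S" and v: "v \<in> laurent_vectors T"
    and add: "\<And>a b. a \<in> S \<Longrightarrow> b \<in> T \<Longrightarrow> a + b \<in> U"
  shows "A *v v \<in> laurent_vectors U"
proof -
  have "Poly_Mapping.keys (A $ i $ j * v $ j) \<subseteq> U" for i j
    using keys_mult[of "A $ i $ j" "v $ j"] A[of i j] v add unfolding laurent_vectors_def by blast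
  moreover have "Poly_Mapping.keys ((A *v v) $ i) \<subseteq> (\<Union>j. Poly_Mapping.keys (A $ i $ j * v $ j))" for i
    unfolding matrix_vector_mult_def vec_lambda_beta by (rule keys_sum)
  ultimately show ?thesis
    unfolding laurent_vectors_def by blast
qed

definition pos_part :: "'k::field laurent ^ 3 \<Rightarrow> 'k laurent ^ 3" where
  "pos_part v = (\<chi> i. Poly_Mapping.mapp (\<lambda>n c. if 0 < n then c else 0) (v $ i))"

lemma lookup_pos_part:
  "Poly_Mapping.lookup (pos_part v $ i) n = (if 0 < n then Poly_Mapping.lookup (v $ i) n else 0)"
  by (simp add: pos_part_def lookup_mapp in_keys_iff when_def)

text \<open>The matrix preserves the vectors without positive exponents, and so does its inverse. It
  therefore acts bijectively on the quotient by them, for which the vectors with only positive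
  exponents form a set of representatives. The bound \<open>n\<close> on the exponents is preserved because the
  entries of the matrix have no positive exponents.\<close>

lemma SL3_moves_positive_part:
  fixes h :: "'k::field laurent ^ 3 ^ 3"
  assumes h: "h \<in> carrier (special_linear polys_in_t_inverse)"
    and fin: "finite (UNIV :: 'k set)"
  shows "bij_betw (\<lambda>v. pos_part (h *v v)) (laurent_vectors {1..n}) (laurent_vectors {1..n})"
proof -
  let ?V = "laurent_vectors {1..n} :: ('k laurent ^ 3) set"
  have neg: "Poly_Mapping.keys (g $ i $ j) \<subseteq> {..0}"
    if "g \<in> carrier (special_linear polys_in_t_inverse)" for g :: "'k laurent ^ 3 ^ 3" and i j
    using that by (auto simp: special_linear_def polys_in_t_inverse_def)
  have "pos_part (h *v v) \<in> ?V" if "v \<in> ?V" for v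
  proof -
    have "h *v v \<in> laurent_vectors {..n}"
      by (rule laurent_vectors_mult[OF neg[OF h] that]) auto
    then show ?thesis
      by (auto simp: laurent_vectors_def in_keys_iff lookup_pos_part subset_iff split: if_splits)
  qed
  moreover have "inj_on (\<lambda>v. pos_part (h *v v)) ?V"
  proof (rule inj_onI)
    fix u v assume u: "u \<in> ?V" and v: "v \<in> ?V" and eq: "pos_part (h *v u) = pos_part (h *v v)"
    obtain k :: "'k laurent ^ 3 ^ 3" where k: "k \<in> carrier (special_linear polys_in_t_inverse)" "k ** h = mat 1"
      using group.l_inv_ex[OF group_SL3 h] by (auto simp: special_linear_def)
    have "Poly_Mapping.lookup ((h *v u) $ i) m = Poly_Mapping.lookup ((h *v v) $ i) m" if "0 < m" for i m
      using arg_cong[OF eq, of "\<lambda>w. Poly_Mapping.lookup (w $ i) m"] that by (simp add: lookup_pos_part)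
    then have "h *v u - h *v v \<in> laurent_vectors {..0}"
      by (auto simp: laurent_vectors_def in_keys_iff lookup_minus) (meson linorder_not_le)
    then have "k *v (h *v u - h *v v) \<in> laurent_vectors {..0}"
      by (rule laurent_vectors_mult[OF neg[OF k(1)]]) auto
    also have "k *v (h *v u - h *v v) = u - v"
    proof -
      have "h *v u = h *v v + h *v (u - v)"
        by (simp flip: matrix_vector_right_distrib)
      then show ?thesis
        by (simp add: matrix_vector_mul_assoc k(2))
    qed
    finally have "Poly_Mapping.lookup (u $ i) m = Poly_Mapping.lookup (v $ i) m" for i m
    proof (cases "m \<le> 0")
      case True
      then have "Poly_Mapping.lookup (w $ i) m = 0" if "w \<in> ?V" for w
        using that by (force simp: laurent_vectors_def in_keys_iff subset_iff)
      then show ?thesis using u v by simp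
    qed (auto simp: laurent_vectors_def in_keys_iff subset_iff lookup_minus)
    then show "u = v"
      by (simp add: vec_eq_iff poly_mapping_eq_iff fun_eq_iff)
  qed
  moreover have "finite ?V"
    by (rule finite_laurent_vectors[OF fin]) simp
  ultimately show ?thesis
    unfolding bij_betw_def using endo_inj_surj[of ?V "\<lambda>v. pos_part (h *v v)"] by blast
qed

text \<open>The range of the remainders is independent of \<open>n\<close>: the vector has only positive exponents,
  so an exponent of the product is at least the least exponent that occurs in the matrix.\<close>

lemma SL3_bounded_remainder:
  fixes h :: "'k::field laurent ^ 3 ^ 3"
  assumes h: "h \<in> carrier (special_linear polys_in_t_inverse)"
  obtains m where "\<And>n v. v \<in> laurent_vectors {1..n} \<Longrightarrow> h *v v - pos_part (h *v v) \<in> laurent_vectors {m..0}"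
proof -
  have "finite (\<Union>i j. Poly_Mapping.keys (h $ i $ j))"
    by simp
  then obtain m where m: "\<And>k. k \<in> (\<Union>i j. Poly_Mapping.keys (h $ i $ j)) \<Longrightarrow> m \<le> k"
    using bdd_below_finite unfolding bdd_below_def by meson
  have "h *v v - pos_part (h *v v) \<in> laurent_vectors {m..0}" if "v \<in> laurent_vectors {1..n}" for n v
  proof -
    have "h *v v \<in> laurent_vectors {m..}"
      by (rule laurent_vectors_mult[OF _ that, of _ "{m..}"]) (use m in auto)
    then show ?thesis
      by (auto simp: laurent_vectors_def in_keys_iff lookup_minus lookup_pos_part subset_iff
          split: if_splits)
  qed
  then show thesis by (rule that)
qed

text \<open>The averaging sets consist of the vectors with exponents between 1 and \<open>n\<close>. For \<open>g = (h, b)\<close>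
  one has \<open>g (1, v) = (h, b + h v)\<close>. Splitting \<open>h v\<close> into its positive part and a remainder \<open>w\<close> turns this into
  the product of \<open>(1, pos_part (h v))\<close> and \<open>(h, b + w)\<close>, and \<open>w\<close> ranges over a finite set.\<close>

lemma not_properly_proximal_SL3_semidirect:
  assumes fin: "finite (UNIV :: 'k::field set)"
  shows "\<not> properly_proximal (SL3_semidirect :: (('k laurent ^ 3 ^ 3) \<times> ('k laurent ^ 3)) monoid)"
proof -
  let ?G = "SL3_semidirect :: (('k laurent ^ 3 ^ 3) \<times> ('k laurent ^ 3)) monoid"
  define V where "V n = (laurent_vectors {1..int n} :: ('k laurent ^ 3) set)" for n
  have fin_V: "finite (V n)" for n
    unfolding V_def by (rule finite_laurent_vectors[OF fin]) simp
  have card_V: "n \<le> card (V n)" for n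
  proof -
    let ?e = "\<lambda>k :: int. (\<chi> i. Poly_Mapping.single k 1) :: 'k laurent ^ 3"
    have "inj_on ?e {1..int n}"
      by (rule inj_onI) (simp add: vec_eq_iff poly_mapping_eq_iff fun_eq_iff lookup_single when_def, metis zero_neq_one)
    moreover have "?e ` {1..int n} \<subseteq> V n"
      by (auto simp: V_def laurent_vectors_def)
    ultimately have "card {1..int n} \<le> card (V n)"
      using fin_V by (rule card_inj_on_le)
    then show ?thesis by simp
  qed
  let ?F = "\<lambda>n. Pair (mat 1) ` V n :: (('k laurent ^ 3 ^ 3) \<times> ('k laurent ^ 3)) set"
  have one: "mat 1 \<in> carrier (special_linear polys_in_t_inverse :: ('k laurent ^ 3 ^ 3) monoid)"
    using group.subgroup_self[OF group_SL3, THEN subgroup.one_closed] by (simp add: special_linear_def)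
  interpret escaping_sequence ?G ?F
  proof (intro escaping_sequence.intro escaping_sequence_axioms.intro group_SL3_semidirect)
    show "?F n \<subseteq> carrier ?G" for n
      using one by (auto simp: SL3_semidirect_simps)
    have "card (?F n) = card (V n)" for n
      by (rule card_image) (simp add: inj_on_def)
    then show "filterlim (\<lambda>n. card (?F n)) at_top sequentially"
      using filterlim_at_top_mono[OF filterlim_ident, of "\<lambda>n. card (V n)"] card_V by simp
  qed (use fin_V in simp)
  show ?thesis
  proof (rule not_properly_proximal)
    fix g assume "g \<in> carrier ?G"
    then obtain h b where g: "g = (h, b)" and h: "h \<in> carrier (special_linear polys_in_t_inverse)"
      by (cases g) (auto simp: SL3_semidirect_simps)
    obtain m where m: "\<And>n v. v \<in> laurent_vectors {1..n} \<Longrightarrow> h *v v - pos_part (h *v v) \<in> laurent_vectors {m..0}"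
      using SL3_bounded_remainder[OF h] by blast
    define R where "R = (\<lambda>w. (h, b + w)) ` (laurent_vectors {m..0} :: ('k laurent ^ 3) set)"
    define \<sigma> where "\<sigma> x = (mat 1 :: 'k laurent ^ 3 ^ 3, pos_part (h *v snd x))" for x :: "('k laurent ^ 3 ^ 3) \<times> ('k laurent ^ 3)"
    have "bij_betw \<sigma> (?F n) (?F n)" for n
      using SL3_moves_positive_part[OF h fin, of "int n"]
      unfolding V_def[symmetric] bij_betw_def by (auto simp: \<sigma>_def inj_on_def image_image)
    moreover have "\<exists>r\<in>R. g \<otimes>\<^bsub>?G\<^esub> x = \<sigma> x \<otimes>\<^bsub>?G\<^esub> r" if "x \<in> ?F n" for x n
    proof -
      obtain v where v: "x = (mat 1, v)" "v \<in> V n" using \<open>x \<in> ?F n\<close> by blast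
      show ?thesis
      proof (rule bexI)
        show "(h, b + (h *v v - pos_part (h *v v))) \<in> R"
          using m[OF v(2)[unfolded V_def]] by (simp add: R_def)
        show "g \<otimes>\<^bsub>?G\<^esub> x = \<sigma> x \<otimes>\<^bsub>?G\<^esub> (h, b + (h *v v - pos_part (h *v v)))"
          by (simp add: g v(1) \<sigma>_def SL3_semidirect_simps)
      qed
    qed
    moreover have "finite R" "R \<subseteq> carrier ?G"
      using finite_laurent_vectors[OF fin, of "{m..0}"] h by (auto simp: R_def SL3_semidirect_simps)
    ultimately show "\<exists>R. finite R \<and> R \<subseteq> carrier ?G \<and> (\<forall>n. \<exists>\<sigma>. bij_betw \<sigma> (?F n) (?F n) \<and>
        (\<forall>x\<in>?F n. \<exists>r\<in>R. g \<otimes>\<^bsub>?G\<^esub> x = \<sigma> x \<otimes>\<^bsub>?G\<^esub> r))"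
      by (intro exI[of _ R] conjI allI exI[of _ \<sigma>] ballI)
  qed
qed

theorem mainTheorem9:
  fixes p :: nat
  assumes "prime p" and "CARD('k::field) = p"
  shows "group (SL3_semidirect :: (('k laurent ^ 3 ^ 3) \<times> ('k laurent ^ 3)) monoid) \<and>
    \<not> inner_amenable (SL3_semidirect :: (('k laurent ^ 3 ^ 3) \<times> ('k laurent ^ 3)) monoid) \<and>
    \<not> properly_proximal (SL3_semidirect :: (('k laurent ^ 3 ^ 3) \<times> ('k laurent ^ 3)) monoid)"
proof -
  have "finite (UNIV :: 'k set)"
    using assms prime_gt_0_nat[of p] by (intro card_ge_0_finite) simp
  then show ?thesis
    using group_SL3_semidirect not_inner_amenable_SL3_semidirect not_properly_proximal_SL3_semidirect
    by blast
qed

end
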